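(* Let $\mathbb{R}\mathrm{Diam}(d)$ denote the maximal number of real diameters of a real-algebraic curve $\Gamma\subset\mathbb{R}^2$ of degree $d$ having no circles as irreducible components. Then $$\mathbb{R}\mathrm{Diam}(d)\ \ge\ \tfrac12 d^4-d^3+\tfrac12 d .$$
   Context: A (real) diameter of a plane curve $\Gamma\subset\mathbb{R}^2$ is a straight segment connecting a pair of points of $\Gamma$ which is perpendicular to the tangent lines to $\Gamma$ at both endpoints. Diameters correspond to crunodes (transversal intersections of two smooth real branches) of the curve of normals of $\Gamma$, i.e. of the curve in the dual plane whose points are the normal lines of $\Gamma$. *)

theory Defs
  imports
    "HOL-Analysis.Analysis"
    "HOL-Computational_Algebra.Polynomial_Factorial"
    "HOL-Computational_Algebra.Squarefree"
    "HOL-Library.Extended_Real"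
begin

text \<open>
  An element \<open>f\<close> of \<open>\<real>[x, y]\<close> is represented in the type \<^typ>\<open>real poly poly\<close>, the outer
  indeterminate being \<open>y\<close>: the coefficient of \<open>x\<^sup>i y\<^sup>j\<close> is \<^term>\<open>coeff (coeff f j) i\<close>.
\<close>

definition eval2 :: "real poly poly \<Rightarrow> real \<times> real \<Rightarrow> real" where
  "eval2 f p = poly (poly f [:snd p:]) (fst p)"

text \<open>Only meaningful for \<open>f \<noteq> 0\<close>.\<close>

definition total_degree :: "real poly poly \<Rightarrow> nat" where
  "total_degree f = Max {i + j | i j. coeff (coeff f j) i \<noteq> 0}"

definition real_locus :: "real poly poly \<Rightarrow> (real \<times> real) set" where
  "real_locus f = {p. eval2 f p = 0}"

definition gradient :: "real poly poly \<Rightarrow> real \<times> real \<Rightarrow> real \<times> real" where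
  "gradient f p = (eval2 (map_poly pderiv f) p, eval2 (pderiv f) p)"

text \<open>
  A real-algebraic curve of degree \<open>d\<close> is given by a reduced equation, so that its degree
  does not depend on superfluous repeated factors.  (Squarefree polynomials are nonzero.)
\<close>

definition algebraic_curve :: "nat \<Rightarrow> real poly poly \<Rightarrow> bool" where
  "algebraic_curve d f \<longleftrightarrow> squarefree f \<and> total_degree f = d"

definition has_circle_component :: "real poly poly \<Rightarrow> bool" where
  "has_circle_component f \<longleftrightarrow>
     (\<exists>g c r. irreducible g \<and> g dvd f \<and> 0 < r \<and> real_locus g = sphere c r)"

definition smooth_points :: "real poly poly \<Rightarrow> (real \<times> real) set" where
  "smooth_points f = {p \<in> real_locus f. gradient f p \<noteq> 0}"

definition tangent_line :: "real poly poly \<Rightarrow> real \<times> real \<Rightarrow> (real \<times> real) set" where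
  "tangent_line f p = {x. gradient f p \<bullet> (x - p) = 0}"

text \<open>
  Endpoints are smooth points, where the curve has a tangent line.  Diameters are collected as
  segments, that is, as point sets, so the two orderings of the endpoints give one diameter.
\<close>

definition diameters :: "real poly poly \<Rightarrow> (real \<times> real) set set" where
  "diameters f = {closed_segment p q | p q.
     p \<in> smooth_points f \<and> q \<in> smooth_points f \<and> p \<noteq> q \<and>
     (\<forall>x \<in> tangent_line f p. (q - p) \<bullet> (x - p) = 0) \<and>
     (\<forall>x \<in> tangent_line f q. (q - p) \<bullet> (x - q) = 0)}"

text \<open>
  The maximal number of diameters, as a supremum in \<^typ>\<open>enat\<close>, over the curves that have
  a finite number of them.  Excluding circles does not by itself ensure finiteness: two parallel
  lines have a continuum of common perpendicular segments, none of which corresponds to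
  a crunode of the curve of normals.  If such curves were admitted, the supremum would be
  infinite for every \<open>d \<ge> 2\<close>.
\<close>

definition RDiam :: "nat \<Rightarrow> enat" where
  "RDiam d = Sup {enat (card (diameters f)) | f.
     algebraic_curve d f \<and> \<not> has_circle_component f \<and> finite (diameters f)}"

end

theory Submission
  imports Defs
begin

text \<open>
  The bound equals \<open>N (N - 1) / 2\<close> for \<open>N = d (d - 1)\<close>, and \<open>N\<close> is the class of a general curve of degree
  \<open>d\<close>: the number of its complex tangents of a given direction. For \<open>d \<ge> 2\<close>, the proof exhibits a curve all of whose
  vertical tangents are real and which has a diameter for every pair of them; for \<open>d = 1\<close> the bound is 0.
  
  Take a curve \<open>A(Y) = B(x)\<close> with \<open>A\<close>, \<open>B\<close> of degree \<open>d\<close> and flatten it: \<open>y = s Y\<close> with small \<open>s > 0\<close>. A chord between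
  \<open>(x1, s Y1)\<close> and \<open>(x2, s Y2)\<close> is normal to the flattened curve at both ends iff
  \<open>(x2 - x1) A'(Yi) + s\<^sup>2 (Y2 - Y1) B'(xi) = 0\<close> for \<open>i = 1, 2\<close>. If \<open>x1 \<noteq> x2\<close>, then for \<open>s = 0\<close> this means
  \<open>A'(Y1) = A'(Y2) = 0\<close>, i.e. both ends are turning points, where the tangent is vertical. Choose \<open>A\<close> and \<open>B\<close> such that
  all \<open>N\<close> turning points are real and nondegenerate and have distinct abscissas
  (\<open>exists_real_turning_points\<close>). Then every pair of them is a nondegenerate solution of the system for \<open>s = 0\<close>, and
  it persists for small \<open>s\<close> and under small perturbations of the equation (\<open>turning_pair_persists\<close>).
  
  It remains to make the number of diameters finite. They form a bounded set, since far away the curve looks like its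
  leading form \<open>a y\<^sup>d = b x\<^sup>d\<close>, a union of lines through the origin (\<open>bounded_double_normals\<close>). So it suffices that
  all of them are isolated and that they do not accumulate at a pair of coinciding points; the latter follows from
  smoothness (\<open>finite_double_normals\<close>). Both hold after adding \<open>c1 y - (c2 x\<^sup>2 + c3 x + c4)\<close> to the equation, for
  almost all \<open>c\<close>: the four equations for a diameter can be solved for \<open>c\<close>, and Sard's theorem applies to the solution
  (\<open>negligible_infinite_double_normals\<close>). Singular points and chords parallel to an axis, where the equations cannot be
  solved in this way, can only do harm for a null set of \<open>c\<close>, by a count of dimensions. Finiteness rules out circles too, because a circle in the curve would contribute
  all its diameters (\<open>no_circle_component\<close>).
\<close>

section \<open>Curves with separated variables\<close>

text \<open>
  The polynomial \<open>P(y) - Q(x)\<close>. For curves \<open>P(y) = Q(x)\<close> both partial derivatives depend on one variable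
  only, which keeps perpendicularity, singular points and squarefreeness elementary.
\<close>

definition sep :: "real poly \<Rightarrow> real poly \<Rightarrow> real poly poly" where
  "sep P Q = map_poly (\<lambda>a. [:a:]) P - [:Q:]"

lemma coeff_sep: "coeff (sep P Q) j = [:coeff P j:] - (if j = 0 then Q else 0)"
  by (simp add: sep_def coeff_map_poly coeff_pCons split: nat.splits)

lemma poly_map_poly_const: "poly (map_poly (\<lambda>a. [:a:]) P) [:y:] = [:poly P y:]"
  for P :: "real poly"
  by (induction P) (simp_all add: map_poly_pCons)

lemma eval2_sep: "eval2 (sep P Q) (x, y) = poly P y - poly Q x"
  by (simp add: eval2_def sep_def poly_map_poly_const)

lemma gradient_sep: "gradient (sep P Q) (x, y) = (- poly (pderiv Q) x, poly (pderiv P) y)"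
proof -
  have "map_poly pderiv (sep P Q) = sep 0 (pderiv Q)"
    by (rule poly_eqI) (simp add: coeff_map_poly coeff_sep pderiv_diff)
  moreover have "pderiv (sep P Q) = sep (pderiv P) 0"
    by (rule poly_eqI) (simp add: coeff_pderiv coeff_sep of_nat_poly)
  ultimately show ?thesis
    by (simp add: gradient_def eval2_sep)
qed

lemma total_degree_sep:
  assumes "degree Q \<le> degree P" "0 < degree P"
  shows "total_degree (sep P Q) = degree P"
  unfolding total_degree_def
proof (rule Max_eqI)
  let ?S = "{i + j | i j. coeff (coeff (sep P Q) j) i \<noteq> 0}"
  show le: "k \<le> degree P" if k_in: "k \<in> ?S" for k
  proof -
    obtain i j where k: "k = i + j" and c: "coeff (coeff (sep P Q) j) i \<noteq> 0"
      using k_in by blast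
    show ?thesis
    proof (cases "j = 0")
      case True
      then have "i = 0 \<or> i \<le> degree Q"
        using c le_degree[of Q i] by (auto simp: coeff_sep coeff_pCons split: nat.splits)
      then show ?thesis
        using assms True k by auto
    next
      case False
      then have "i = 0 \<and> coeff P j \<noteq> 0"
        using c by (auto simp: coeff_sep coeff_pCons split: nat.splits)
      then show ?thesis
        using k le_degree[of P j] by simp
    qed
  qed
  show "finite ?S"
    by (rule finite_subset[of _ "{..degree P}"]) (use le in auto)
  have "coeff (coeff (sep P Q) (degree P)) 0 \<noteq> 0"
    using assms by (auto simp: coeff_sep)
  then show "degree P \<in> ?S"
    by force
qed

text \<open>
  With \<open>D\<close> either of the two partial derivatives, this passes a repeated factor of a polynomial on to its gradient.
\<close>

lemma dvd_derivation:
  fixes D :: "'a::comm_ring_1 \<Rightarrow> 'a"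
  assumes "\<And>a b. D (a * b) = D a * b + a * D b"
  shows "g dvd D (g * g * h)"
proof -
  have "D (g * g * h) = g * (D g * h + D g * h + g * D h)"
    using assms by (simp add: algebra_simps)
  then show ?thesis
    by (rule dvdI)
qed

text \<open>
  A repeated factor divides both partial derivatives \<open>P'(y)\<close> and \<open>- Q'(x)\<close>. The second makes it free of
  \<open>y\<close>, and then it divides every coefficient of \<open>P'(y)\<close>, which are constants.
\<close>

lemma squarefree_sep:
  assumes "0 < degree P" "0 < degree Q"
  shows "squarefree (sep P Q)"
proof (rule squarefreeI)
  fix g
  assume "g\<^sup>2 dvd sep P Q"
  then obtain h where h: "sep P Q = g * g * h"
    by (auto simp: power2_eq_square elim: dvdE)
  have leibniz: "pderiv (a * b) = pderiv a * b + a * pderiv b" for a b :: "real poly poly"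
    by (simp add: pderiv_mult algebra_simps)
  have "pderiv (sep P Q) = sep (pderiv P) 0"
    by (rule poly_eqI) (simp add: coeff_pderiv coeff_sep of_nat_poly)
  then have dy: "g dvd sep (pderiv P) 0"
    unfolding h by (metis dvd_derivation[of pderiv] leibniz)
  have leibniz_x: "pderiv (a * b) = pderiv a * b + a * pderiv b" for a b :: "real poly"
    by (simp add: pderiv_mult algebra_simps)
  have coeff_dx: "map_poly pderiv (a * b) = map_poly pderiv a * b + a * map_poly pderiv b"
    for a b :: "real poly poly"
    by (rule poly_eqI)
      (simp add: coeff_map_poly coeff_mult higher_pderiv_sum[of 1, simplified] leibniz_x sum.distrib)
  have "map_poly pderiv (sep P Q) = [:- pderiv Q:]"
    by (rule poly_eqI) (simp add: coeff_map_poly coeff_sep pderiv_diff coeff_pCons split: nat.splits)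
  then have dx: "g dvd [:- pderiv Q:]"
    unfolding h by (metis dvd_derivation[of "map_poly pderiv"] coeff_dx)
  have "pderiv Q \<noteq> 0" "pderiv P \<noteq> 0"
    using assms by (auto simp: pderiv_eq_0_iff)
  then have "degree g = 0"
    using dvd_imp_degree_le[OF dx] by simp
  then obtain k where k: "g = [:k:]"
    by (rule degree_eq_zeroE)
  have "k dvd coeff (sep (pderiv P) 0) (degree (pderiv P))"
    using dy unfolding k const_poly_dvd_iff by blast
  then have "k dvd [:lead_coeff (pderiv P):]"
    by (simp add: coeff_sep)
  also have "[:lead_coeff (pderiv P):] dvd 1"
    using \<open>pderiv P \<noteq> 0\<close> by (simp add: is_unit_const_poly_iff dvd_field_iff)
  finally show "g dvd 1"
    unfolding k by (simp add: is_unit_const_poly_iff)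
qed

text \<open>
  The two linear conditions say that the vector \<open>(x2 - x1, y2 - y1)\<close> is parallel to the gradient
  \<open>(- Q', P')\<close> at either end. Coordinates are separate arguments because later
  arguments treat the four of them as independent unknowns.
\<close>

definition double_normal :: "real poly \<Rightarrow> real poly \<Rightarrow> real \<Rightarrow> real \<Rightarrow> real \<Rightarrow> real \<Rightarrow> bool" where
  "double_normal P Q x1 y1 x2 y2 \<longleftrightarrow>
     poly P y1 = poly Q x1 \<and> poly P y2 = poly Q x2 \<and> (x1, y1) \<noteq> (x2, y2) \<and>
     (x2 - x1) * poly (pderiv P) y1 + (y2 - y1) * poly (pderiv Q) x1 = 0 \<and>
     (x2 - x1) * poly (pderiv P) y2 + (y2 - y1) * poly (pderiv Q) x2 = 0"

lemma double_normal_flip: "double_normal P Q x1 y1 x2 y2 \<Longrightarrow> double_normal P Q x2 y2 x1 y1"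
  unfolding double_normal_def by (auto simp: algebra_simps)

text \<open>
  Exchanging the axes exchanges \<open>P\<close> and \<open>Q\<close>; every statement about horizontal chords thus gives
  one about vertical chords.
\<close>

lemma double_normal_transpose: "double_normal P Q x1 y1 x2 y2 \<longleftrightarrow> double_normal Q P y1 x1 y2 x2"
  unfolding double_normal_def by (auto simp: algebra_simps)

definition smooth_curve :: "real poly \<Rightarrow> real poly \<Rightarrow> bool" where
  "smooth_curve P Q \<longleftrightarrow>
     (\<forall>x y. poly P y = poly Q x \<longrightarrow> poly (pderiv P) y = 0 \<longrightarrow> poly (pderiv Q) x \<noteq> 0)"

text \<open>
  For the implication from left to right it suffices to test the point of the tangent line reached from \<open>p\<close> by the gradient turned
  through a right angle.
\<close>

lemma perpendicular_tangent_line_iff: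
  fixes f p v
  assumes "gradient f p \<noteq> 0"
  shows "(\<forall>x \<in> tangent_line f p. v \<bullet> (x - p) = 0) \<longleftrightarrow>
    fst (gradient f p) * snd v = snd (gradient f p) * fst v"
proof -
  obtain a b where g: "gradient f p = (a, b)" by fastforce
  obtain u w where v: "v = (u, w)" by fastforce
  have ab: "a \<noteq> 0 \<or> b \<noteq> 0"
    using assms g by (auto simp: zero_prod_def)
  show ?thesis
  proof
    assume "\<forall>x \<in> tangent_line f p. v \<bullet> (x - p) = 0"
    moreover have "p + (- b, a) \<in> tangent_line f p"
      by (simp add: tangent_line_def g)
    ultimately have "v \<bullet> (p + (- b, a) - p) = 0" by blast
    then show "fst (gradient f p) * snd v = snd (gradient f p) * fst v"
      by (simp add: g v algebra_simps)
  next
    assume par: "fst (gradient f p) * snd v = snd (gradient f p) * fst v"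
    show "\<forall>x \<in> tangent_line f p. v \<bullet> (x - p) = 0"
    proof
      fix x assume "x \<in> tangent_line f p"
      then obtain m n where x: "x - p = (m, n)" and 0: "a * m + b * n = 0"
        by (cases "x - p") (auto simp: tangent_line_def g)
      have "a * (u * m + w * n) = 0" "b * (u * m + w * n) = 0"
        using par 0 unfolding g v by (simp; algebra)+
      then show "v \<bullet> (x - p) = 0"
        using ab by (auto simp: x v)
    qed
  qed
qed

lemma diameters_sep:
  assumes "smooth_curve P Q"
  shows "diameters (sep P Q) =
    {closed_segment (x1, y1) (x2, y2) | x1 y1 x2 y2. double_normal P Q x1 y1 x2 y2}"
proof -
  have smooth: "(x, y) \<in> smooth_points (sep P Q) \<longleftrightarrow> poly P y = poly Q x" for x y
    using assms by (auto simp: smooth_points_def real_locus_def eval2_sep gradient_sep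
        smooth_curve_def zero_prod_def)
  have perp: "(\<forall>z \<in> tangent_line (sep P Q) (x, y). (u, v) \<bullet> (z - (x, y)) = 0) \<longleftrightarrow>
      u * poly (pderiv P) y + v * poly (pderiv Q) x = 0"
    if "poly P y = poly Q x" for x y u v
    using perpendicular_tangent_line_iff[of "sep P Q" "(x, y)" "(u, v)"] that smooth[of x y]
    by (auto simp: smooth_points_def gradient_sep algebra_simps)
  have "((x1, y1) \<in> smooth_points (sep P Q) \<and> (x2, y2) \<in> smooth_points (sep P Q) \<and>
      (x1, y1) \<noteq> (x2, y2) \<and>
      (\<forall>x \<in> tangent_line (sep P Q) (x1, y1). ((x2, y2) - (x1, y1)) \<bullet> (x - (x1, y1)) = 0) \<and>
      (\<forall>x \<in> tangent_line (sep P Q) (x2, y2). ((x2, y2) - (x1, y1)) \<bullet> (x - (x2, y2)) = 0)) \<longleftrightarrow>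
      double_normal P Q x1 y1 x2 y2" for x1 y1 x2 y2
    unfolding double_normal_def smooth diff_Pair by (metis perp)
  then show ?thesis
    unfolding diameters_def by simp
qed

text \<open>
  Differentiating the equation of the curve along the circle shows that the gradient of the curve is
  radial at every point of the circle, so every diameter of the circle is normal to the curve at both ends.
\<close>

lemma antipodal_points_double_normal:
  fixes c :: "real \<times> real"
  assumes "0 < r" "sphere c r \<subseteq> real_locus (sep P Q)"
  shows "double_normal P Q (fst c + r * cos t) (snd c + r * sin t)
           (fst c - r * cos t) (snd c - r * sin t)"
proof -
  have on: "poly P (snd c + r * sin s) = poly Q (fst c + r * cos s)" for s
  proof -
    have "(c + r *\<^sub>R (cos s, sin s)) \<in> sphere c r"
      using assms(1) by (simp add: dist_norm norm_Pair power_mult_distrib real_sqrt_mult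
          flip: distrib_left)
    then have "eval2 (sep P Q) (c + r *\<^sub>R (cos s, sin s)) = 0"
      using assms(2) unfolding real_locus_def by blast
    then show ?thesis
      by (cases c) (simp add: eval2_sep)
  qed
  have tang: "r * cos s * poly (pderiv P) (snd c + r * sin s)
      + r * sin s * poly (pderiv Q) (fst c + r * cos s) = 0" for s
  proof -
    have "((\<lambda>s. poly P (snd c + r * sin s) - poly Q (fst c + r * cos s)) has_real_derivative
       poly (pderiv P) (snd c + r * sin s) * (r * cos s)
        - poly (pderiv Q) (fst c + r * cos s) * (r * - sin s)) (at s)"
      by (auto intro!: derivative_eq_intros DERIV_chain2[OF poly_DERIV])
    moreover have "(\<lambda>s. poly P (snd c + r * sin s) - poly Q (fst c + r * cos s)) = (\<lambda>s. 0)"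
      using on by simp
    ultimately have "poly (pderiv P) (snd c + r * sin s) * (r * cos s)
        - poly (pderiv Q) (fst c + r * cos s) * (r * - sin s) = 0"
      by (metis DERIV_const DERIV_unique)
    then show ?thesis by (simp add: algebra_simps)
  qed
  have ne: "r * cos t \<noteq> 0 \<or> r * sin t \<noteq> 0"
    using assms(1) sin_zero_norm_cos_one[of t] by auto
  have uv: "fst c - r * cos t - (fst c + r * cos t) = - 2 * (r * cos t)"
    "snd c - r * sin t - (snd c + r * sin t) = - 2 * (r * sin t)"
    by simp_all
  have scale: "- 2 * a * A + - 2 * b * B = 0" if "a * A + b * B = 0" for a b A B :: real
    using that by (simp add: algebra_simps)
  have on': "poly P (snd c - r * sin t) = poly Q (fst c - r * cos t)"
    using on[of "t + pi"] by simp
  have tang': "r * cos t * poly (pderiv P) (snd c - r * sin t)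
      + r * sin t * poly (pderiv Q) (fst c - r * cos t) = 0"
    using tang[of "t + pi"] by simp
  have "(fst c + r * cos t, snd c + r * sin t) \<noteq> (fst c - r * cos t, snd c - r * sin t)"
    using ne by auto
  then show ?thesis
    unfolding double_normal_def uv using on[of t] on' scale[OF tang[of t]] scale[OF tang'] by blast
qed

text \<open>
  A circle in the curve would contribute the infinitely many pairs of its antipodal points.
\<close>

lemma no_circle_component:
  assumes fin: "finite {(x1, y1, x2, y2). double_normal P Q x1 y1 x2 y2}"
  shows "\<not> has_circle_component (sep P Q)"
proof
  assume "has_circle_component (sep P Q)"
  then obtain g c r where g: "g dvd sep P Q" "0 < r" "real_locus g = sphere c r"
    unfolding has_circle_component_def by blast
  have "real_locus g \<subseteq> real_locus (sep P Q)"
    using g(1) by (auto simp: real_locus_def eval2_def elim!: dvdE)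
  then have dn: "double_normal P Q (fst c + r * cos t) (snd c + r * sin t)
           (fst c - r * cos t) (snd c - r * sin t)" for t
    using antipodal_points_double_normal g(2,3) by simp
  let ?F = "\<lambda>t. (fst c + r * cos t, snd c + r * sin t, fst c - r * cos t, snd c - r * sin t)"
  have "inj_on ?F {0..pi}"
    using g(2) cos_inj_pi by (auto simp: inj_on_def)
  moreover have "finite (?F ` {0..pi})"
    by (rule finite_subset[OF _ fin]) (use dn in auto)
  ultimately have "finite {0..pi}"
    using finite_imageD by blast
  then show False
    using infinite_Icc[of 0 pi] pi_gt_zero by simp
qed

section \<open>Boundedness of the set of diameters\<close>

lemma poly_mean_value:
  fixes p :: "real poly"
  obtains c where "c \<in> closed_segment a b" "poly p b - poly p a = (b - a) * poly (pderiv p) c"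
proof -
  consider "a < b" | "a = b" | "b < a" by linarith
  then show ?thesis
  proof cases
    case 1
    then obtain c where "a < c" "c < b" "poly p b - poly p a = (b - a) * poly (pderiv p) c"
      using poly_MVT by blast
    then show ?thesis
      using that[of c] by (auto simp: closed_segment_eq_real_ivl)
  next
    case 2
    then show ?thesis using that[of a] by simp
  next
    case 3
    then obtain c where "b < c" "c < a" "poly p a - poly p b = (a - b) * poly (pderiv p) c"
      using poly_MVT by blast
    then show ?thesis
      using that[of c] by (auto simp: closed_segment_eq_real_ivl algebra_simps)
  qed
qed

text \<open>
  By the mean value theorem in \<open>x\<close> and in \<open>y\<close>, the chord is orthogonal to the gradient of \<open>P(y) - Q(x)\<close>
  at some \<open>(\<xi>, \<eta>)\<close> of the box spanned by its ends, while it is parallel to the gradient at \<open>(x1, y1)\<close>. So the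
  two gradients are orthogonal. Along a sequence of pairs whose ends merge, the limit of this
  identity says that the gradient vanishes.
\<close>

lemma double_normal_tangent_turns:
  assumes "double_normal P Q x1 y1 x2 y2"
  obtains \<xi> \<eta> where "\<xi> \<in> closed_segment x1 x2" "\<eta> \<in> closed_segment y1 y2"
    "poly (pderiv P) \<eta> * poly (pderiv P) y1 + poly (pderiv Q) \<xi> * poly (pderiv Q) x1 = 0"
proof -
  obtain \<eta> where \<eta>: "\<eta> \<in> closed_segment y1 y2"
    "poly P y2 - poly P y1 = (y2 - y1) * poly (pderiv P) \<eta>"
    by (rule poly_mean_value)
  obtain \<xi> where \<xi>: "\<xi> \<in> closed_segment x1 x2"
    "poly Q x2 - poly Q x1 = (x2 - x1) * poly (pderiv Q) \<xi>"
    by (rule poly_mean_value)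
  define a b a1 b1 u v where "a = poly (pderiv P) \<eta>" and "b = poly (pderiv Q) \<xi>"
    and "a1 = poly (pderiv P) y1" and "b1 = poly (pderiv Q) x1"
    and "u = x2 - x1" and "v = y2 - y1"
  have eqs: "v * a = u * b" "u * a1 + v * b1 = 0" and "u \<noteq> 0 \<or> v \<noteq> 0"
    using assms \<xi> \<eta> unfolding double_normal_def a_def b_def a1_def b1_def u_def v_def by auto
  \<comment> \<open>The linear system for \<open>(u, v)\<close> has a nonzero solution, so its determinant vanishes.\<close>
  moreover have "(a * a1 + b * b1) * u = 0" "(a * a1 + b * b1) * v = 0"
    using eqs by algebra+
  ultimately have "a * a1 + b * b1 = 0"
    by auto
  then show ?thesis
    using that \<xi>(1) \<eta>(1) unfolding a_def b_def a1_def b1_def by blast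
qed

lemma tendsto_in_closed_segment:
  fixes a b c :: "nat \<Rightarrow> real"
  assumes "a \<longlonglongrightarrow> l" "b \<longlonglongrightarrow> l" "\<And>k. c k \<in> closed_segment (a k) (b k)"
  shows "c \<longlonglongrightarrow> l"
proof (rule tendsto_sandwich)
  have "min (a k) (b k) \<le> c k \<and> c k \<le> max (a k) (b k)" for k
    using assms(3)[of k] by (auto simp: closed_segment_eq_real_ivl min_def max_def split: if_splits)
  then show "\<forall>\<^sub>F k in sequentially. min (a k) (b k) \<le> c k" "\<forall>\<^sub>F k in sequentially. c k \<le> max (a k) (b k)"
    by simp_all
  show "(\<lambda>k. min (a k) (b k)) \<longlonglongrightarrow> l" "(\<lambda>k. max (a k) (b k)) \<longlonglongrightarrow> l"
    using tendsto_min[OF assms(1,2)] tendsto_max[OF assms(1,2)] by simp_all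
qed

text \<open>
  Under rescaling by \<open>r \<rightarrow> \<infinity>\<close> only the term of degree \<open>n\<close> survives.
\<close>

lemma poly_scaled_limit:
  fixes p :: "real poly"
  assumes "degree p \<le> n" and r: "filterlim r at_top sequentially"
    and y: "(\<lambda>k. y k / r k) \<longlonglongrightarrow> l"
  shows "(\<lambda>k. poly p (y k) / r k ^ n) \<longlonglongrightarrow> coeff p n * l ^ n"
proof -
  have inv: "(\<lambda>k. 1 / r k) \<longlonglongrightarrow> 0"
    using tendsto_inverse_0_at_top[OF r] by (simp add: inverse_eq_divide)
  have eq: "poly p x = (\<Sum>i\<le>n. coeff p i * x ^ i)" for x
    unfolding poly_altdef using assms(1)
    by (intro sum.mono_neutral_left) (auto simp: coeff_eq_0)
  have "(\<lambda>k. \<Sum>i\<le>n. coeff p i * (y k / r k) ^ i * (1 / r k) ^ (n - i))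
      \<longlonglongrightarrow> (\<Sum>i\<le>n. coeff p i * l ^ i * 0 ^ (n - i))"
    by (intro tendsto_intros y inv)
  also have "(\<Sum>i\<le>n. coeff p i * l ^ i * 0 ^ (n - i)) = (\<Sum>i\<in>{n}. coeff p i * l ^ i * 0 ^ (n - i))"
    by (rule sum.mono_neutral_right) auto
  finally have lim: "(\<lambda>k. \<Sum>i\<le>n. coeff p i * (y k / r k) ^ i * (1 / r k) ^ (n - i))
      \<longlonglongrightarrow> coeff p n * l ^ n"
    by simp
  have "\<forall>\<^sub>F k in sequentially. 0 < r k"
    using r by (simp add: filterlim_at_top_dense)
  then have "\<forall>\<^sub>F k in sequentially.
     (\<Sum>i\<le>n. coeff p i * (y k / r k) ^ i * (1 / r k) ^ (n - i)) = poly p (y k) / r k ^ n"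
  proof eventually_elim
    case (elim k)
    have "coeff p i * (y k / r k) ^ i * (1 / r k) ^ (n - i) = coeff p i * y k ^ i / r k ^ n"
      if "i \<le> n" for i
      using elim power_add[of "r k" i "n - i"] that by (simp add: power_divide)
    then show ?case
      by (simp add: eq sum_divide_distrib)
  qed
  then show ?thesis
    using lim by (rule Lim_transform_eventually[rotated])
qed

text \<open>
  On the leading form \<open>a y\<^sup>d = b x\<^sup>d\<close> the tangents are radial, by Euler's identity. The last hypothesis
  therefore says that \<open>(x2 - x1, y2 - y1)\<close> is orthogonal to the unit vector \<open>(x1, y1)\<close>, and
  a point of the unit disc on the tangent of the unit circle at \<open>(x1, y1)\<close> can only be \<open>(x1, y1)\<close>.
\<close>

lemma asymptotic_direction:
  fixes a b :: real
  assumes nz: "a \<noteq> 0" "b \<noteq> 0" and d: "1 \<le> d"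
    and on: "a * y1 ^ d = b * x1 ^ d" and unit: "x1\<^sup>2 + y1\<^sup>2 = 1" and le: "x2\<^sup>2 + y2\<^sup>2 \<le> 1"
    and perp: "(x2 - x1) * (a * y1 ^ (d - 1)) + (y2 - y1) * (b * x1 ^ (d - 1)) = 0"
  shows "x2 = x1" "y2 = y1" "x1 \<noteq> 0" "y1 \<noteq> 0"
proof -
  have pow: "z ^ d = z * z ^ (d - 1)" for z :: real
    using d by (cases d) auto
  have zero_iff: "x1 = 0 \<longleftrightarrow> y1 = 0"
    using on nz d by (metis mult_eq_0_iff power_eq_0_iff zero_power not_gr0 not_one_le_zero)
  then show x1: "x1 \<noteq> 0" and y1: "y1 \<noteq> 0"
    using unit by auto
  have "x1 * y1 * ((x2 - x1) * (a * y1 ^ (d - 1)) + (y2 - y1) * (b * x1 ^ (d - 1)))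
      = (x2 - x1) * x1 * (a * y1 ^ d) + (y2 - y1) * y1 * (b * x1 ^ d)"
    unfolding pow by (simp add: algebra_simps)
  also have "\<dots> = ((x2 - x1) * x1 + (y2 - y1) * y1) * (b * x1 ^ d)"
    unfolding on by (simp add: algebra_simps)
  finally have "((x2 - x1) * x1 + (y2 - y1) * y1) * (b * x1 ^ d)
      = x1 * y1 * ((x2 - x1) * (a * y1 ^ (d - 1)) + (y2 - y1) * (b * x1 ^ (d - 1)))" ..
  then have "(x2 - x1) * x1 + (y2 - y1) * y1 = 0"
    using perp nz x1 by simp
  then have "(x2 - x1)\<^sup>2 + (y2 - y1)\<^sup>2 \<le> 0"
    using unit le by (simp add: power2_eq_square algebra_simps)
  then show "x2 = x1" "y2 = y1"
    by (simp_all add: sum_power2_le_zero_iff)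
qed

text \<open>
  Rescale both ends by the norm of the larger one and pass to the limit. The limit points lie on the
  leading form and coincide by the preceding lemma, so both ends run off in the same direction. But then
  the gradients at the ends and in the box between them have, after rescaling, a common nonzero
  limit, against the orthogonality found above.
\<close>

lemma double_normals_no_escape:
  fixes x1 y1 x2 y2 :: "nat \<Rightarrow> real"
  assumes deg: "degree P = d" "degree Q = d" "1 \<le> d"
    and dn: "\<And>k. double_normal P Q (x1 k) (y1 k) (x2 k) (y2 k)"
    and le: "\<And>k. norm (x2 k, y2 k) \<le> norm (x1 k, y1 k)"
    and large: "\<And>k. real k < norm (x1 k, y1 k)"
  shows False
proof -
  define s where "s k = norm (x1 k, y1 k)" for k
  have s_pos: "0 < s k" for k
    using le_less_trans[OF of_nat_0_le_iff large[of k]] by (simp only: s_def)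
  have coord: "\<bar>x1 k / s k\<bar> \<le> 1" "\<bar>y1 k / s k\<bar> \<le> 1" "\<bar>x2 k / s k\<bar> \<le> 1" "\<bar>y2 k / s k\<bar> \<le> 1" for k
    using s_pos[of k] le[of k] norm_fst_le[of "x1 k" "y1 k"] norm_snd_le[of "y1 k" "x1 k"]
      norm_fst_le[of "x2 k" "y2 k"] norm_snd_le[of "y2 k" "x2 k"]
    by (auto simp: s_def)
  define g where "g k = (x1 k / s k, y1 k / s k, x2 k / s k, y2 k / s k)" for k
  have "g k \<in> {-1..1} \<times> {-1..1} \<times> {-1..1} \<times> {-1..1}" for k
    using coord[of k, unfolded abs_le_iff minus_le_iff[of _ 1]]
    unfolding g_def mem_Times_iff fst_conv snd_conv atLeastAtMost_iff by blast
  then have "range g \<subseteq> {-1..1} \<times> {-1..1} \<times> {-1..1} \<times> {-1..1}"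
    by blast
  then have "bounded (range g)"
    by (rule bounded_subset[rotated]) (intro bounded_Times bounded_closed_interval)
  then obtain l and \<rho> :: "nat \<Rightarrow> nat" where \<rho>: "strict_mono \<rho>" and lim: "(g \<circ> \<rho>) \<longlonglongrightarrow> l"
    using bounded_imp_convergent_subsequence by blast
  obtain X1 Y1 X2 Y2 where l: "l = (X1, Y1, X2, Y2)"
    by (metis surj_pair)
  define r where "r = s \<circ> \<rho>"
  have r_pos: "0 < r k" for k
    using s_pos by (simp add: r_def)
  have X1: "(\<lambda>k. x1 (\<rho> k) / r k) \<longlonglongrightarrow> X1" and Y1: "(\<lambda>k. y1 (\<rho> k) / r k) \<longlonglongrightarrow> Y1"
    and X2: "(\<lambda>k. x2 (\<rho> k) / r k) \<longlonglongrightarrow> X2" and Y2: "(\<lambda>k. y2 (\<rho> k) / r k) \<longlonglongrightarrow> Y2"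
    using tendsto_fst[OF lim] tendsto_fst[OF tendsto_snd[OF lim]]
      tendsto_fst[OF tendsto_snd[OF tendsto_snd[OF lim]]]
      tendsto_snd[OF tendsto_snd[OF tendsto_snd[OF lim]]]
    by (simp_all add: g_def l r_def o_def)
  have r: "filterlim r at_top sequentially"
  proof (rule filterlim_at_top_mono[OF filterlim_real_sequentially])
    have "real k \<le> r k" for k
      using large[of "\<rho> k"] seq_suble[OF \<rho>, of k] by (simp add: r_def s_def)
    then show "\<forall>\<^sub>F k in sequentially. real k \<le> r k" by simp
  qed
  define a b where "a = lead_coeff P" and "b = lead_coeff Q"
  have nz: "a \<noteq> 0" "b \<noteq> 0"
    unfolding a_def b_def leading_coeff_0_iff using deg by auto
  have cP: "coeff P d = a" "coeff (pderiv P) (d - 1) = d * a"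
    and cQ: "coeff Q d = b" "coeff (pderiv Q) (d - 1) = d * b"
    using deg by (simp_all add: a_def b_def coeff_pderiv)
  have dP: "degree (pderiv P) \<le> d - 1" "degree P \<le> d" and dQ: "degree (pderiv Q) \<le> d - 1" "degree Q \<le> d"
    using deg by (simp_all add: degree_pderiv)
  note limP = poly_scaled_limit[OF dP(2) r, unfolded cP]
  note limQ = poly_scaled_limit[OF dQ(2) r, unfolded cQ]
  note limP' = poly_scaled_limit[OF dP(1) r, unfolded cP]
  note limQ' = poly_scaled_limit[OF dQ(1) r, unfolded cQ]
  have "poly P (y1 (\<rho> k)) = poly Q (x1 (\<rho> k))" for k
    using dn[of "\<rho> k"] by (simp add: double_normal_def)
  then have on: "a * Y1 ^ d = b * X1 ^ d"
    using LIMSEQ_unique[OF limP[OF Y1]] limQ[OF X1] by simp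
  have norm_sq: "(x1 (\<rho> k) / r k)\<^sup>2 + (y1 (\<rho> k) / r k)\<^sup>2 = 1" for k
  proof -
    have "(x1 (\<rho> k))\<^sup>2 + (y1 (\<rho> k))\<^sup>2 = (r k)\<^sup>2"
      by (simp add: r_def s_def norm_Pair)
    then show ?thesis
      using r_pos[of k] by (simp add: power_divide flip: add_divide_distrib)
  qed
  have "(\<lambda>k. (x1 (\<rho> k) / r k)\<^sup>2 + (y1 (\<rho> k) / r k)\<^sup>2) \<longlonglongrightarrow> X1\<^sup>2 + Y1\<^sup>2"
    by (intro tendsto_intros X1 Y1)
  then have unit: "X1\<^sup>2 + Y1\<^sup>2 = 1"
    unfolding norm_sq by (simp add: LIMSEQ_const_iff)
  have norm_sq2: "(x2 (\<rho> k) / r k)\<^sup>2 + (y2 (\<rho> k) / r k)\<^sup>2 \<le> 1" for k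
  proof -
    have "(norm (x2 (\<rho> k), y2 (\<rho> k)))\<^sup>2 \<le> (r k)\<^sup>2"
      using le[of "\<rho> k"] by (intro power_mono) (simp_all add: r_def s_def)
    then have "(x2 (\<rho> k))\<^sup>2 + (y2 (\<rho> k))\<^sup>2 \<le> (r k)\<^sup>2"
      by (simp add: norm_Pair)
    then show ?thesis
      using r_pos[of k] by (simp add: power_divide flip: add_divide_distrib)
  qed
  have "(\<lambda>k. (x2 (\<rho> k) / r k)\<^sup>2 + (y2 (\<rho> k) / r k)\<^sup>2) \<longlonglongrightarrow> X2\<^sup>2 + Y2\<^sup>2"
    by (intro tendsto_intros X2 Y2)
  then have in_disc: "X2\<^sup>2 + Y2\<^sup>2 \<le> 1"
    by (rule LIMSEQ_le_const2) (use norm_sq2 in blast)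
  have "(\<lambda>k. (x2 (\<rho> k) / r k - x1 (\<rho> k) / r k) * (poly (pderiv P) (y1 (\<rho> k)) / r k ^ (d - 1)) +
        (y2 (\<rho> k) / r k - y1 (\<rho> k) / r k) * (poly (pderiv Q) (x1 (\<rho> k)) / r k ^ (d - 1)))
      \<longlonglongrightarrow> (X2 - X1) * (d * a * Y1 ^ (d - 1)) + (Y2 - Y1) * (d * b * X1 ^ (d - 1))"
    by (intro tendsto_intros X1 X2 Y1 Y2 limP' limQ')
  moreover have "(x2 (\<rho> k) / r k - x1 (\<rho> k) / r k) * (poly (pderiv P) (y1 (\<rho> k)) / r k ^ (d - 1)) +
        (y2 (\<rho> k) / r k - y1 (\<rho> k) / r k) * (poly (pderiv Q) (x1 (\<rho> k)) / r k ^ (d - 1)) = 0" for k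
  proof -
    have "(x2 (\<rho> k) / r k - x1 (\<rho> k) / r k) * (poly (pderiv P) (y1 (\<rho> k)) / r k ^ (d - 1)) +
        (y2 (\<rho> k) / r k - y1 (\<rho> k) / r k) * (poly (pderiv Q) (x1 (\<rho> k)) / r k ^ (d - 1)) =
        ((x2 (\<rho> k) - x1 (\<rho> k)) * poly (pderiv P) (y1 (\<rho> k)) +
         (y2 (\<rho> k) - y1 (\<rho> k)) * poly (pderiv Q) (x1 (\<rho> k))) / (r k * r k ^ (d - 1))"
      by (simp add: add_divide_distrib flip: diff_divide_distrib)
    also have "\<dots> = 0"
      using dn[of "\<rho> k"] by (simp add: double_normal_def)
    finally show ?thesis .
  qed
  ultimately have "(X2 - X1) * (d * a * Y1 ^ (d - 1)) + (Y2 - Y1) * (d * b * X1 ^ (d - 1)) = 0"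
    by (simp add: LIMSEQ_const_iff)
  then have "d * ((X2 - X1) * (a * Y1 ^ (d - 1)) + (Y2 - Y1) * (b * X1 ^ (d - 1))) = 0"
    by (simp add: algebra_simps)
  then have "(X2 - X1) * (a * Y1 ^ (d - 1)) + (Y2 - Y1) * (b * X1 ^ (d - 1)) = 0"
    using deg(3) by simp
  from asymptotic_direction[OF nz deg(3) on unit in_disc this]
  have eq: "X2 = X1" "Y2 = Y1" and ne: "X1 \<noteq> 0" "Y1 \<noteq> 0"
    by blast+
  have "\<exists>\<xi> \<eta>. \<xi> \<in> closed_segment (x1 k) (x2 k) \<and> \<eta> \<in> closed_segment (y1 k) (y2 k) \<and>
      poly (pderiv P) \<eta> * poly (pderiv P) (y1 k) + poly (pderiv Q) \<xi> * poly (pderiv Q) (x1 k) = 0" for k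
    using double_normal_tangent_turns[OF dn[of k]] by metis
  then obtain \<xi> \<eta> where \<xi>: "\<And>k. \<xi> k \<in> closed_segment (x1 k) (x2 k)"
    and \<eta>: "\<And>k. \<eta> k \<in> closed_segment (y1 k) (y2 k)"
    and turn: "\<And>k. poly (pderiv P) (\<eta> k) * poly (pderiv P) (y1 k)
        + poly (pderiv Q) (\<xi> k) * poly (pderiv Q) (x1 k) = 0"
    by metis
  have seg: "c / r k \<in> closed_segment (a / r k) (b / r k)" if "c \<in> closed_segment a b" for a b c k
    using that r_pos[of k] by (auto simp: closed_segment_eq_real_ivl divide_le_cancel split: if_splits)
  have \<xi>': "(\<lambda>k. \<xi> (\<rho> k) / r k) \<longlonglongrightarrow> X1"
    by (rule tendsto_in_closed_segment[OF X1 X2[unfolded eq]]) (intro seg \<xi>)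
  have \<eta>': "(\<lambda>k. \<eta> (\<rho> k) / r k) \<longlonglongrightarrow> Y1"
    by (rule tendsto_in_closed_segment[OF Y1 Y2[unfolded eq]]) (intro seg \<eta>)
  have "(\<lambda>k. poly (pderiv P) (\<eta> (\<rho> k)) / r k ^ (d - 1) * (poly (pderiv P) (y1 (\<rho> k)) / r k ^ (d - 1)) +
      poly (pderiv Q) (\<xi> (\<rho> k)) / r k ^ (d - 1) * (poly (pderiv Q) (x1 (\<rho> k)) / r k ^ (d - 1)))
      \<longlonglongrightarrow> d * a * Y1 ^ (d - 1) * (d * a * Y1 ^ (d - 1)) + d * b * X1 ^ (d - 1) * (d * b * X1 ^ (d - 1))"
    by (intro tendsto_intros X1 Y1 \<xi>' \<eta>' limP' limQ')
  moreover have "poly (pderiv P) (\<eta> (\<rho> k)) / r k ^ (d - 1) * (poly (pderiv P) (y1 (\<rho> k)) / r k ^ (d - 1)) +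
      poly (pderiv Q) (\<xi> (\<rho> k)) / r k ^ (d - 1) * (poly (pderiv Q) (x1 (\<rho> k)) / r k ^ (d - 1)) = 0" for k
    using turn[of "\<rho> k"] by (simp flip: add_divide_distrib)
  ultimately have "(d * a * Y1 ^ (d - 1))\<^sup>2 + (d * b * X1 ^ (d - 1))\<^sup>2 = 0"
    by (simp add: LIMSEQ_const_iff power2_eq_square)
  then show False
    using nz ne deg(3) by (simp add: sum_power2_eq_zero_iff)
qed

lemma bounded_double_normals:
  assumes deg: "degree P = d" "degree Q = d" "1 \<le> d"
  shows "bounded {(x1, y1, x2, y2). double_normal P Q x1 y1 x2 y2}"
proof -
  have "\<exists>R. \<forall>x1 y1 x2 y2. double_normal P Q x1 y1 x2 y2 \<longrightarrow>
      norm (x2, y2) \<le> norm (x1, y1) \<longrightarrow> norm (x1, y1) \<le> R"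
  proof (rule ccontr)
    assume "\<not> ?thesis"
    then have "\<forall>k. \<exists>x1 y1 x2 y2. double_normal P Q x1 y1 x2 y2 \<and>
      norm (x2, y2) \<le> norm (x1, y1) \<and> real k < norm (x1, y1)"
      by (meson not_le)
    then obtain x1 y1 x2 y2 where "\<forall>k. double_normal P Q (x1 k) (y1 k) (x2 k) (y2 k) \<and>
      norm (x2 k, y2 k) \<le> norm (x1 k, y1 k) \<and> real k < norm (x1 k, y1 k)"
      by metis
    then show False
      using double_normals_no_escape[OF deg, of x1 y1 x2 y2] by blast
  qed
  then obtain R where R: "double_normal P Q x1 y1 x2 y2 \<Longrightarrow> norm (x2, y2) \<le> norm (x1, y1) \<Longrightarrow>
      norm (x1, y1) \<le> R" for x1 y1 x2 y2
    by blast
  have both: "norm (x1, y1) \<le> R \<and> norm (x2, y2) \<le> R" if dn: "double_normal P Q x1 y1 x2 y2" for x1 y1 x2 y2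
    using R[OF dn] R[OF double_normal_flip[OF dn]] by linarith
  have box: "x1 \<in> {-R..R} \<and> y1 \<in> {-R..R} \<and> x2 \<in> {-R..R} \<and> y2 \<in> {-R..R}"
    if "double_normal P Q x1 y1 x2 y2" for x1 y1 x2 y2
  proof -
    have "\<bar>x1\<bar> \<le> R \<and> \<bar>y1\<bar> \<le> R \<and> \<bar>x2\<bar> \<le> R \<and> \<bar>y2\<bar> \<le> R"
      using both[OF that] norm_fst_le[of x1 y1] norm_snd_le[of y1 x1]
        norm_fst_le[of x2 y2] norm_snd_le[of y2 x2] by simp
    then show ?thesis
      by (simp add: abs_le_iff minus_le_iff)
  qed
  have "{(x1, y1, x2, y2). double_normal P Q x1 y1 x2 y2} \<subseteq>
      {-R..R} \<times> {-R..R} \<times> {-R..R} \<times> {-R..R}"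
    using box by (auto simp del: atLeastAtMost_iff)
  then show ?thesis
    by (rule bounded_subset[rotated]) (intro bounded_Times bounded_closed_interval)
qed

section \<open>Finiteness of the set of diameters\<close>

text \<open>
  The last equation is the limit, as a chord becomes horizontal, of the difference of the two perpendicularity
  conditions divided by \<open>y2 - y1\<close>. Where it fails, a horizontal double normal is not a limit of others that
  are not horizontal.
\<close>

definition degenerate_horizontal :: "real poly \<Rightarrow> real poly \<Rightarrow> bool" where
  "degenerate_horizontal P Q \<longleftrightarrow> (\<exists>y x1 x2. x1 \<noteq> x2 \<and> poly P y = poly Q x1 \<and> poly P y = poly Q x2 \<and>
     poly (pderiv P) y = 0 \<and>
     (x2 - x1) * poly (pderiv (pderiv P)) y + poly (pderiv Q) x2 - poly (pderiv Q) x1 = 0)"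

text \<open>
  Chords parallel to an axis are kept apart because a perturbation \<open>c1 y - (c2 x\<^sup>2 + c3 x + c4)\<close> of the equation
  moves the perpendicularity conditions at the two ends independently of each other only where
  \<open>x1 \<noteq> x2\<close> and \<open>y1 \<noteq> y2\<close>.
\<close>

definition slanted_isolated :: "real poly \<Rightarrow> real poly \<Rightarrow> bool" where
  "slanted_isolated P Q \<longleftrightarrow> (\<forall>x1 y1 x2 y2. x1 \<noteq> x2 \<longrightarrow> y1 \<noteq> y2 \<longrightarrow>
     \<not> (x1, y1, x2, y2) islimpt {(x1, y1, x2, y2). double_normal P Q x1 y1 x2 y2})"

lemma tendsto_poly [tendsto_intros]:
  fixes p :: "real poly"
  assumes "(f \<longlongrightarrow> a) F"
  shows "((\<lambda>x. poly p (f x)) \<longlongrightarrow> poly p a) F"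
  using assms by (rule isCont_tendsto_compose[OF poly_isCont])

lemma limit_on_curve:
  fixes x y :: "nat \<Rightarrow> real"
  assumes "x \<longlonglongrightarrow> X" "y \<longlonglongrightarrow> Y" "\<And>k. poly P (y k) = poly Q (x k)"
  shows "poly P Y = poly Q X"
proof (rule LIMSEQ_unique)
  show "(\<lambda>k. poly P (y k)) \<longlonglongrightarrow> poly P Y"
    by (intro tendsto_intros assms)
  show "(\<lambda>k. poly P (y k)) \<longlonglongrightarrow> poly Q X"
    unfolding assms(3) by (intro tendsto_intros assms)
qed

text \<open>
  Subtracting the two perpendicularity conditions and dividing by \<open>y2 - y1 \<noteq> 0\<close> gives an equation that
  survives in the limit.
\<close>

lemma horizontal_limit_degenerate:
  fixes x1 y1 x2 y2 :: "nat \<Rightarrow> real"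
  assumes dn: "\<And>k. double_normal P Q (x1 k) (y1 k) (x2 k) (y2 k)" and "\<And>k. y1 k \<noteq> y2 k"
    and lim: "x1 \<longlonglongrightarrow> X1" "y1 \<longlonglongrightarrow> Y" "x2 \<longlonglongrightarrow> X2" "y2 \<longlonglongrightarrow> Y" and "X1 \<noteq> X2"
  shows "degenerate_horizontal P Q"
proof -
  have "\<exists>\<eta>. \<eta> \<in> closed_segment (y1 k) (y2 k) \<and> (x2 k - x1 k) * poly (pderiv (pderiv P)) \<eta>
      + poly (pderiv Q) (x2 k) - poly (pderiv Q) (x1 k) = 0" for k
  proof -
    obtain \<eta> where \<eta>: "\<eta> \<in> closed_segment (y1 k) (y2 k)" "poly (pderiv P) (y2 k)
        - poly (pderiv P) (y1 k) = (y2 k - y1 k) * poly (pderiv (pderiv P)) \<eta>"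
      by (rule poly_mean_value)
    have "(x2 k - x1 k) * (poly (pderiv P) (y2 k) - poly (pderiv P) (y1 k))
        + (y2 k - y1 k) * (poly (pderiv Q) (x2 k) - poly (pderiv Q) (x1 k)) = 0"
      using dn[of k] by (simp add: double_normal_def algebra_simps)
    then have "(y2 k - y1 k) * ((x2 k - x1 k) * poly (pderiv (pderiv P)) \<eta>
      + poly (pderiv Q) (x2 k) - poly (pderiv Q) (x1 k)) = 0"
      unfolding \<eta>(2) by (simp add: algebra_simps)
    then show ?thesis
      using \<eta>(1) assms(2)[of k] by auto
  qed
  then obtain \<eta> where \<eta>: "\<And>k. \<eta> k \<in> closed_segment (y1 k) (y2 k)"
    and eq: "\<And>k. (x2 k - x1 k) * poly (pderiv (pderiv P)) (\<eta> k)
      + poly (pderiv Q) (x2 k) - poly (pderiv Q) (x1 k) = 0"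
    by metis
  have \<eta>': "\<eta> \<longlonglongrightarrow> Y"
    by (rule tendsto_in_closed_segment[OF lim(2,4) \<eta>])
  have "(\<lambda>k. (x2 k - x1 k) * poly (pderiv (pderiv P)) (\<eta> k)
      + poly (pderiv Q) (x2 k) - poly (pderiv Q) (x1 k)) \<longlonglongrightarrow>
      (X2 - X1) * poly (pderiv (pderiv P)) Y + poly (pderiv Q) X2 - poly (pderiv Q) X1"
    by (intro tendsto_intros lim \<eta>')
  then have 1: "(X2 - X1) * poly (pderiv (pderiv P)) Y + poly (pderiv Q) X2 - poly (pderiv Q) X1 = 0"
    unfolding eq by (simp add: LIMSEQ_const_iff)
  have "(\<lambda>k. (x2 k - x1 k) * poly (pderiv P) (y1 k) + (y2 k - y1 k) * poly (pderiv Q) (x1 k))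
      \<longlonglongrightarrow> (X2 - X1) * poly (pderiv P) Y + (Y - Y) * poly (pderiv Q) X1"
    by (intro tendsto_intros lim)
  moreover have "(x2 k - x1 k) * poly (pderiv P) (y1 k) + (y2 k - y1 k) * poly (pderiv Q) (x1 k) = 0" for k
    using dn[of k] by (simp add: double_normal_def)
  ultimately have 2: "poly (pderiv P) Y = 0"
    using \<open>X1 \<noteq> X2\<close> by (simp add: LIMSEQ_const_iff)
  have "poly P Y = poly Q X1"
    using lim(1,2) by (rule limit_on_curve) (use dn in \<open>auto simp: double_normal_def\<close>)
  moreover have "poly P Y = poly Q X2"
    using lim(3,4) by (rule limit_on_curve) (use dn in \<open>auto simp: double_normal_def\<close>)
  ultimately have "poly P Y = poly Q X1" "poly P Y = poly Q X2" .
  then show ?thesis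
    using 1 2 \<open>X1 \<noteq> X2\<close> unfolding degenerate_horizontal_def by blast
qed

text \<open>
  Both ends have vertical tangents, and a curve \<open>P(y) = Q(x)\<close> has finitely many points with \<open>P'(y) = 0\<close>.
\<close>

lemma finite_horizontal_double_normals:
  assumes "degree P = d" "degree Q = d" "1 \<le> d"
  shows "finite {(x1, y1, x2, y2). double_normal P Q x1 y1 x2 y2 \<and> y1 = y2}"
proof -
  have "pderiv P \<noteq> 0"
    using assms by (auto simp: pderiv_eq_0_iff)
  define Ys where "Ys = {y. poly (pderiv P) y = 0}"
  define Xs where "Xs = (\<Union>y\<in>Ys. {x. poly (Q - [:poly P y:]) x = 0})"
  have fib: "finite {x. poly (Q - [:c:]) x = 0}" for c
    by (rule poly_roots_finite) (use assms in auto)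
  have Ys: "finite Ys"
    unfolding Ys_def using \<open>pderiv P \<noteq> 0\<close> by (rule poly_roots_finite)
  moreover have "finite Xs"
    unfolding Xs_def by (intro finite_UN_I Ys fib)
  ultimately have fin: "finite Ys" "finite Xs" .
  have "{(x1, y1, x2, y2). double_normal P Q x1 y1 x2 y2 \<and> y1 = y2} \<subseteq> Xs \<times> Ys \<times> Xs \<times> Ys"
    by (auto simp: double_normal_def Xs_def Ys_def)
  then show ?thesis
    by (rule finite_subset) (simp add: fin)
qed

text \<open>
  Infinitely many pairs would accumulate, as they form a bounded set. The limit is not a pair
  of coinciding points, because the curve is smooth; the other three positions of the limit are excluded by the three
  nondegeneracy hypotheses.
\<close>

lemma finite_double_normals:
  assumes deg: "degree P = d" "degree Q = d" "1 \<le> d"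
    and smooth: "smooth_curve P Q"
    and nondeg: "\<not> degenerate_horizontal P Q" "\<not> degenerate_horizontal Q P"
    and isolated: "slanted_isolated P Q"
  shows "finite {(x1, y1, x2, y2). double_normal P Q x1 y1 x2 y2}" (is "finite ?D")
proof -
  let ?S = "{(x1, y1, x2, y2). double_normal P Q x1 y1 x2 y2 \<and> x1 \<noteq> x2 \<and> y1 \<noteq> y2}"
  let ?H = "{(x1, y1, x2, y2). double_normal P Q x1 y1 x2 y2 \<and> y1 = y2}"
  let ?V = "{(x1, y1, x2, y2). double_normal P Q x1 y1 x2 y2 \<and> x1 = x2}"
  have H: "finite ?H"
    using finite_horizontal_double_normals deg by blast
  have "?V = (\<lambda>(y1, x1, y2, x2). (x1, y1, x2, y2)) `
      {(y1, x1, y2, x2). double_normal Q P y1 x1 y2 x2 \<and> x1 = x2}"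
    by (auto simp: image_iff double_normal_transpose[of P Q])
  then have V: "finite ?V"
    using finite_horizontal_double_normals[OF deg(2,1,3)] by simp
  have S: "finite ?S"
  proof (rule ccontr)
    assume "infinite ?S"
    moreover have "bounded ?S"
      by (rule bounded_subset[OF bounded_double_normals[OF deg]]) auto
    ultimately obtain l where l: "l islimpt ?S"
      using bounded_infinite_imp_islimpt[of ?S ?S] by blast
    obtain X1 Y1 X2 Y2 where l_eq: "l = (X1, Y1, X2, Y2)"
      by (metis surj_pair)
    obtain g where g: "\<And>k. g k \<in> ?S - {l}" and lim: "g \<longlonglongrightarrow> l"
      using iffD1[OF islimpt_sequential l] by blast
    define x1 y1 x2 y2 where "x1 k = fst (g k)" and "y1 k = fst (snd (g k))"
      and "x2 k = fst (snd (snd (g k)))" and "y2 k = snd (snd (snd (g k)))" for k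
    have dn: "double_normal P Q (x1 k) (y1 k) (x2 k) (y2 k)" and ne: "x1 k \<noteq> x2 k" "y1 k \<noteq> y2 k" for k
      using g[of k] by (auto simp: x1_def y1_def x2_def y2_def)
    have X1: "x1 \<longlonglongrightarrow> X1" and Y1: "y1 \<longlonglongrightarrow> Y1" and X2: "x2 \<longlonglongrightarrow> X2" and Y2: "y2 \<longlonglongrightarrow> Y2"
      using tendsto_fst[OF lim] tendsto_fst[OF tendsto_snd[OF lim]]
        tendsto_fst[OF tendsto_snd[OF tendsto_snd[OF lim]]]
        tendsto_snd[OF tendsto_snd[OF tendsto_snd[OF lim]]]
      by (simp_all add: l_eq x1_def[abs_def] y1_def[abs_def] x2_def[abs_def] y2_def[abs_def])
    consider "X1 = X2" "Y1 = Y2" | "X1 \<noteq> X2" "Y1 \<noteq> Y2" | "X1 \<noteq> X2" "Y1 = Y2" | "X1 = X2" "Y1 \<noteq> Y2"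
      by blast
    then show False
    proof cases
      case 1
      have "\<exists>\<xi> \<eta>. \<xi> \<in> closed_segment (x1 k) (x2 k) \<and> \<eta> \<in> closed_segment (y1 k) (y2 k) \<and>
          poly (pderiv P) \<eta> * poly (pderiv P) (y1 k) + poly (pderiv Q) \<xi> * poly (pderiv Q) (x1 k) = 0" for k
        using double_normal_tangent_turns[OF dn[of k]] by metis
      then obtain \<xi> \<eta> where \<xi>: "\<And>k. \<xi> k \<in> closed_segment (x1 k) (x2 k)"
        and \<eta>: "\<And>k. \<eta> k \<in> closed_segment (y1 k) (y2 k)"
        and turn: "\<And>k. poly (pderiv P) (\<eta> k) * poly (pderiv P) (y1 k)
            + poly (pderiv Q) (\<xi> k) * poly (pderiv Q) (x1 k) = 0"
        by metis
      have \<xi>': "\<xi> \<longlonglongrightarrow> X1"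
        by (rule tendsto_in_closed_segment[OF X1 X2[folded 1(1)] \<xi>])
      have \<eta>': "\<eta> \<longlonglongrightarrow> Y1"
        by (rule tendsto_in_closed_segment[OF Y1 Y2[folded 1(2)] \<eta>])
      have "(\<lambda>k. poly (pderiv P) (\<eta> k) * poly (pderiv P) (y1 k)
          + poly (pderiv Q) (\<xi> k) * poly (pderiv Q) (x1 k)) \<longlonglongrightarrow>
          poly (pderiv P) Y1 * poly (pderiv P) Y1 + poly (pderiv Q) X1 * poly (pderiv Q) X1"
        by (intro tendsto_intros X1 Y1 \<xi>' \<eta>')
      then have "(poly (pderiv P) Y1)\<^sup>2 + (poly (pderiv Q) X1)\<^sup>2 = 0"
        unfolding turn by (simp add: LIMSEQ_const_iff power2_eq_square)
      then have "poly (pderiv P) Y1 = 0" "poly (pderiv Q) X1 = 0"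
        by (simp_all add: sum_power2_eq_zero_iff)
      moreover have "poly P (y1 k) = poly Q (x1 k)" for k
        using dn[of k] by (auto simp: double_normal_def)
      with X1 Y1 have "poly P Y1 = poly Q X1"
        by (rule limit_on_curve)
      ultimately show False
        using smooth unfolding smooth_curve_def by blast
    next
      case 2
      have "l islimpt ?D"
        by (rule islimpt_subset[OF l]) auto
      then show False
        using isolated 2 unfolding slanted_isolated_def l_eq by blast
    next
      case 3
      then show False
        using horizontal_limit_degenerate[OF dn ne(2) X1 Y1 X2] Y2 nondeg(1) by simp
    next
      case 4
      have "double_normal Q P (y1 k) (x1 k) (y2 k) (x2 k)" for k
        using dn double_normal_transpose by blast
      then show False
        using horizontal_limit_degenerate[of Q P y1 x1 y2 x2 Y1 X1 Y2] ne(1) X1 Y1 Y2 X2 4 nondeg(2)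
        by simp
    qed
  qed
  have "?D \<subseteq> ?S \<union> ?H \<union> ?V" by auto
  then show ?thesis
    by (rule finite_subset) (simp only: finite_Un S H V)
qed

section \<open>Generic perturbations\<close>

definition vec4 :: "real \<Rightarrow> real \<Rightarrow> real \<Rightarrow> real \<Rightarrow> real^4" where
  "vec4 a b c d = (\<chi> i. if i = 1 then a else if i = 2 then b else if i = 3 then c else d)"

lemma vec4_nth [simp]:
  "vec4 a b c d $ 1 = a" "vec4 a b c d $ 2 = b" "vec4 a b c d $ 3 = c" "vec4 a b c d $ 4 = d"
  by (simp_all add: vec4_def)

lemma vec4_eq_iff: "v = vec4 a b c d \<longleftrightarrow> v $ 1 = a \<and> v $ 2 = b \<and> v $ 3 = c \<and> v $ 4 = d"
  by (simp add: vec_eq_iff forall_4)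

lemma vec4_as_sum:
  "vec4 a b c d = a *\<^sub>R axis 1 1 + b *\<^sub>R axis 2 1 + c *\<^sub>R axis 3 1 + d *\<^sub>R axis 4 1"
  by (simp add: vec_eq_iff forall_4 axis_def)

lemma has_derivative_vec4:
  assumes "(f has_derivative f') F" "(g has_derivative g') F" "(h has_derivative h') F"
    "(k has_derivative k') F"
  shows "((\<lambda>z. vec4 (f z) (g z) (h z) (k z)) has_derivative
    (\<lambda>z. vec4 (f' z) (g' z) (h' z) (k' z))) F"
  unfolding vec4_as_sum by (intro derivative_intros assms)

lemma differentiable_vec4 [derivative_intros]:
  assumes "f differentiable F" "g differentiable F" "h differentiable F" "k differentiable F"
  shows "(\<lambda>z. vec4 (f z) (g z) (h z) (k z)) differentiable F"
  by (rule differentiableI[OF has_derivative_vec4[OF assms[unfolded frechet_derivative_works]]])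

lemma continuous_on_vec4 [continuous_intros]:
  assumes "continuous_on S f" "continuous_on S g" "continuous_on S h" "continuous_on S k"
  shows "continuous_on S (\<lambda>z. vec4 (f z) (g z) (h z) (k z))"
  unfolding vec4_as_sum by (intro continuous_intros assms)

lemma tendsto_vec4 [tendsto_intros]:
  assumes "(f \<longlongrightarrow> a) F" "(g \<longlongrightarrow> b) F" "(h \<longlongrightarrow> c) F" "(k \<longlongrightarrow> d) F"
  shows "((\<lambda>z. vec4 (f z) (g z) (h z) (k z)) \<longlongrightarrow> vec4 a b c d) F"
  unfolding vec4_as_sum by (intro tendsto_intros assms)

lemma has_derivative_poly:
  fixes p :: "real poly"
  assumes "(f has_derivative f') (at x within S)"
  shows "((\<lambda>z. poly p (f z)) has_derivative (\<lambda>h. poly (pderiv p) (f x) * f' h)) (at x within S)"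
  using has_derivative_compose[OF assms, of "poly p" "\<lambda>h. poly (pderiv p) (f x) * h"] poly_DERIV[of p "f x"]
  by (simp add: has_field_derivative_def mult.commute[of _ "poly _ _"])

lemma differentiable_poly [derivative_intros]:
  fixes p :: "real poly"
  assumes "f differentiable (at x within S)"
  shows "(\<lambda>z. poly p (f z)) differentiable (at x within S)"
  using assms has_derivative_poly unfolding differentiable_def by blast

lemma differentiable_vec_nth [derivative_intros]:
  "(\<lambda>z::real^'n. z $ i) differentiable F"
  using bounded_linear.has_derivative[OF bounded_linear_vec_nth has_derivative_ident]
  unfolding differentiable_def by blast

lemma differentiable_fst [derivative_intros]:
  assumes "f differentiable F"
  shows "(\<lambda>z. fst (f z)) differentiable F"
  by (rule differentiableI[OF has_derivative_fst[OF assms[unfolded frechet_derivative_works]]])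

lemma differentiable_snd [derivative_intros]:
  assumes "f differentiable F"
  shows "(\<lambda>z. snd (f z)) differentiable F"
  by (rule differentiableI[OF has_derivative_snd[OF assms[unfolded frechet_derivative_works]]])

text \<open>
  Four parameters are added to the equation of the curve, which keeps its variables separated. Four is the number of
  equations that a diameter satisfies, so that the parameters can be expressed by the ends of the diameter.
\<close>

definition perturb_y :: "real^4 \<Rightarrow> real poly \<Rightarrow> real poly" where
  "perturb_y c P = P + [:0, c $ 1:]"

definition perturb_x :: "real^4 \<Rightarrow> real poly \<Rightarrow> real poly" where
  "perturb_x c Q = Q + [:c $ 4, c $ 3, c $ 2:]"

lemma poly_perturb:
  "poly (perturb_y c P) y = poly P y + c $ 1 * y"
  "poly (pderiv (perturb_y c P)) y = poly (pderiv P) y + c $ 1"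
  "poly (pderiv (pderiv (perturb_y c P))) y = poly (pderiv (pderiv P)) y"
  "poly (perturb_x c Q) x = poly Q x + c $ 2 * x\<^sup>2 + c $ 3 * x + c $ 4"
  "poly (pderiv (perturb_x c Q)) x = poly (pderiv Q) x + 2 * c $ 2 * x + c $ 3"
  "poly (pderiv (pderiv (perturb_x c Q))) x = poly (pderiv (pderiv Q)) x + 2 * c $ 2"
  by (simp_all add: perturb_y_def perturb_x_def pderiv_add pderiv_pCons power2_eq_square algebra_simps)

lemma degree_perturb_y: "2 \<le> degree P \<Longrightarrow> degree (perturb_y c P) = degree P"
  unfolding perturb_y_def by (subst degree_add_eq_left) (simp_all add: degree_pCons_eq_if)

lemma degree_perturb_x:
  assumes "2 \<le> degree Q" "c $ 2 \<noteq> - coeff Q 2"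
  shows "degree (perturb_x c Q) = degree Q"
proof (cases "degree Q = 2")
  case True
  show ?thesis
  proof (rule antisym)
    show "degree (perturb_x c Q) \<le> degree Q"
      unfolding perturb_x_def using True by (intro degree_add_le) (simp_all add: degree_pCons_eq_if)
    show "degree Q \<le> degree (perturb_x c Q)"
      unfolding perturb_x_def using True assms(2)
      by (intro le_degree) (simp add: numeral_2_eq_2)
  qed
next
  case False
  then show ?thesis
    unfolding perturb_x_def using assms(1)
    by (intro degree_add_eq_left) (simp add: degree_pCons_eq_if)
qed

text \<open>
  The curve through a prescribed singular point is determined by the point and the parameter with index 2, so
  the parameters in question lie in the differentiable image of a space of dimension three. The two lemmas
  that follow rest on the same count: three coordinates of a degenerate chord determine all four parameters.
\<close>

lemma negligible_singular:
  "negligible {c. \<not> smooth_curve (perturb_y c P) (perturb_x c Q)}"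
proof -
  define c1 c3 where "c1 w = - poly (pderiv P) (snd (snd w))"
    and "c3 w = - poly (pderiv Q) (fst w) - 2 * fst (snd w) * fst w" for w :: "real \<times> real \<times> real"
  define f where "f w = vec4 (c1 w) (fst (snd w)) (c3 w)
     (poly P (snd (snd w)) + c1 w * snd (snd w) - poly Q (fst w) - fst (snd w) * (fst w)\<^sup>2 - c3 w * fst w)" for w
  have "f differentiable_on UNIV"
    unfolding differentiable_on_def f_def c1_def c3_def by (intro ballI derivative_intros)
  then have "negligible (range f)"
    by (rule negligible_differentiable_image_lowdim[rotated]) simp
  moreover have "{c. \<not> smooth_curve (perturb_y c P) (perturb_x c Q)} \<subseteq> range f"
  proof
    fix c assume "c \<in> {c. \<not> smooth_curve (perturb_y c P) (perturb_x c Q)}"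
    then obtain x y where eq: "poly P y + c $ 1 * y = poly Q x + c $ 2 * x\<^sup>2 + c $ 3 * x + c $ 4"
      "poly (pderiv P) y + c $ 1 = 0" "poly (pderiv Q) x + 2 * c $ 2 * x + c $ 3 = 0"
      unfolding smooth_curve_def poly_perturb by blast
    have "c1 (x, c $ 2, y) = c $ 1" "c3 (x, c $ 2, y) = c $ 3"
      using eq by (simp_all add: c1_def c3_def)
    then have "c = f (x, c $ 2, y)"
      unfolding f_def vec4_eq_iff using eq by simp
    then show "c \<in> range f" by blast
  qed
  ultimately show ?thesis
    by (rule negligible_subset)
qed

lemma negligible_degenerate_horizontal:
  "negligible {c. degenerate_horizontal (perturb_y c P) (perturb_x c Q)}"
proof -
  define S where "S = {w::real \<times> real \<times> real. fst (snd w) \<noteq> snd (snd w)}"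
  define y x1 x2 where "y w = fst w" and "x1 w = fst (snd w)" and "x2 w = snd (snd w)"
    for w :: "real \<times> real \<times> real"
  define c1 where "c1 w = - poly (pderiv P) (y w)" for w
  define c2 where "c2 w = - ((x2 w - x1 w) * poly (pderiv (pderiv P)) (y w)
      + poly (pderiv Q) (x2 w) - poly (pderiv Q) (x1 w)) / (2 * (x2 w - x1 w))" for w
  define c3 where "c3 w = - (poly Q (x2 w) - poly Q (x1 w)) / (x2 w - x1 w) - c2 w * (x1 w + x2 w)" for w
  define f where "f w = vec4 (c1 w) (c2 w) (c3 w)
     (poly P (y w) + c1 w * y w - poly Q (x1 w) - c2 w * (x1 w)\<^sup>2 - c3 w * x1 w)" for w
  have "f differentiable_on S"
  proof (rule differentiable_at_imp_differentiable_on)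
    fix w assume "w \<in> S"
    then have ne: "x2 w - x1 w \<noteq> 0" "2 * (x2 w - x1 w) \<noteq> 0"
      by (auto simp: S_def x1_def x2_def)
    have 1: "y differentiable (at w)" "x1 differentiable (at w)" "x2 differentiable (at w)"
      unfolding y_def x1_def x2_def by (intro derivative_intros)+
    have 2: "c1 differentiable (at w)"
      unfolding c1_def by (intro derivative_intros 1)
    have 3: "c2 differentiable (at w)"
      unfolding c2_def by (intro derivative_intros 1 ne)
    have 4: "c3 differentiable (at w)"
      unfolding c3_def by (intro derivative_intros 1 3 ne)
    show "f differentiable (at w)"
      unfolding f_def by (intro derivative_intros 1 2 3 4)
  qed
  then have "negligible (f ` S)"
    by (rule negligible_differentiable_image_lowdim[rotated]) simp
  moreover have "{c. degenerate_horizontal (perturb_y c P) (perturb_x c Q)} \<subseteq> f ` S"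
  proof
    fix c assume "c \<in> {c. degenerate_horizontal (perturb_y c P) (perturb_x c Q)}"
    then obtain y' x1' x2' where ne: "x1' \<noteq> x2'"
      and on1: "poly P y' + c $ 1 * y' = poly Q x1' + c $ 2 * x1'\<^sup>2 + c $ 3 * x1' + c $ 4"
      and on2: "poly P y' + c $ 1 * y' = poly Q x2' + c $ 2 * x2'\<^sup>2 + c $ 3 * x2' + c $ 4"
      and crit: "poly (pderiv P) y' + c $ 1 = 0"
      and deg: "(x2' - x1') * poly (pderiv (pderiv P)) y' + (poly (pderiv Q) x2' + 2 * c $ 2 * x2' + c $ 3)
        - (poly (pderiv Q) x1' + 2 * c $ 2 * x1' + c $ 3) = 0"
      unfolding degenerate_horizontal_def poly_perturb by blast
    define w where "w = (y', x1', x2')"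
    have [simp]: "y w = y'" "x1 w = x1'" "x2 w = x2'"
      by (simp_all add: y_def x1_def x2_def w_def)
    have C1: "c1 w = c $ 1"
      using crit by (simp add: c1_def)
    have C2: "c2 w = c $ 2"
      using deg ne by (simp add: c2_def field_simps)
    have chord: "poly Q x2' - poly Q x1' = (x2' - x1') * - (c $ 2 * (x1' + x2') + c $ 3)"
      using on1 on2 by (simp add: algebra_simps power2_eq_square)
    have "- (poly Q x2' - poly Q x1') / (x2' - x1') = c $ 2 * (x1' + x2') + c $ 3"
      unfolding chord using ne by simp
    then have C3: "c3 w = c $ 3"
      by (simp add: c3_def C2)
    have "c = f w"
      unfolding f_def vec4_eq_iff using C1 C2 C3 on1 by simp
    moreover have "w \<in> S" using ne by (simp add: S_def w_def)
    ultimately show "c \<in> f ` S" by blast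
  qed
  ultimately show ?thesis
    by (rule negligible_subset)
qed

lemma negligible_degenerate_vertical:
  "negligible {c. degenerate_horizontal (perturb_x c Q) (perturb_y c P)}"
proof -
  define S where "S = {w::real \<times> real \<times> real. fst (snd w) \<noteq> snd (snd w)}"
  define x y1 y2 where "x w = fst w" and "y1 w = fst (snd w)" and "y2 w = snd (snd w)"
    for w :: "real \<times> real \<times> real"
  define c1 where "c1 w = - (poly P (y2 w) - poly P (y1 w)) / (y2 w - y1 w)" for w
  define c2 where "c2 w = - (poly (pderiv (pderiv Q)) (x w)
      + (poly (pderiv P) (y2 w) - poly (pderiv P) (y1 w)) / (y2 w - y1 w)) / 2" for w
  define c3 where "c3 w = - poly (pderiv Q) (x w) - 2 * c2 w * x w" for w
  define f where "f w = vec4 (c1 w) (c2 w) (c3 w)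
     (poly P (y1 w) + c1 w * y1 w - poly Q (x w) - c2 w * (x w)\<^sup>2 - c3 w * x w)" for w
  have "f differentiable_on S"
  proof (rule differentiable_at_imp_differentiable_on)
    fix w assume "w \<in> S"
    then have ne: "y2 w - y1 w \<noteq> 0"
      by (auto simp: S_def y1_def y2_def)
    have 1: "x differentiable (at w)" "y1 differentiable (at w)" "y2 differentiable (at w)"
      unfolding x_def y1_def y2_def by (intro derivative_intros)+
    have 2: "c1 differentiable (at w)"
      unfolding c1_def by (intro derivative_intros 1 ne)
    have 3: "c2 differentiable (at w)"
      unfolding c2_def by (intro derivative_intros 1 ne) simp
    have 4: "c3 differentiable (at w)"
      unfolding c3_def by (intro derivative_intros 1 3 ne)
    show "f differentiable (at w)"
      unfolding f_def by (intro derivative_intros 1 2 3 4)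
  qed
  then have "negligible (f ` S)"
    by (rule negligible_differentiable_image_lowdim[rotated]) simp
  moreover have "{c. degenerate_horizontal (perturb_x c Q) (perturb_y c P)} \<subseteq> f ` S"
  proof
    fix c assume "c \<in> {c. degenerate_horizontal (perturb_x c Q) (perturb_y c P)}"
    then obtain x' y1' y2' where ne: "y1' \<noteq> y2'"
      and on1: "poly Q x' + c $ 2 * x'\<^sup>2 + c $ 3 * x' + c $ 4 = poly P y1' + c $ 1 * y1'"
      and on2: "poly Q x' + c $ 2 * x'\<^sup>2 + c $ 3 * x' + c $ 4 = poly P y2' + c $ 1 * y2'"
      and crit: "poly (pderiv Q) x' + 2 * c $ 2 * x' + c $ 3 = 0"
      and deg: "(y2' - y1') * (poly (pderiv (pderiv Q)) x' + 2 * c $ 2) + (poly (pderiv P) y2' + c $ 1)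
        - (poly (pderiv P) y1' + c $ 1) = 0"
      unfolding degenerate_horizontal_def poly_perturb by blast
    define w where "w = (x', y1', y2')"
    have [simp]: "x w = x'" "y1 w = y1'" "y2 w = y2'"
      by (simp_all add: x_def y1_def y2_def w_def)
    have "poly P y2' - poly P y1' = (y2' - y1') * - c $ 1"
      using on1 on2 by (simp add: algebra_simps)
    then have C1: "c1 w = c $ 1"
      using ne by (simp add: c1_def)
    have "poly (pderiv P) y2' - poly (pderiv P) y1' =
        (y2' - y1') * - (poly (pderiv (pderiv Q)) x' + 2 * c $ 2)"
      using deg by (simp add: algebra_simps)
    then have C2: "c2 w = c $ 2"
      using ne by (simp add: c2_def)
    have C3: "c3 w = c $ 3"
      using crit by (simp add: c3_def C2)
    have "c = f w"
      unfolding f_def vec4_eq_iff using C1 C2 C3 on1 by simp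
    moreover have "w \<in> S" using ne by (simp add: S_def w_def)
    ultimately show "c \<in> f ` S" by blast
  qed
  ultimately show ?thesis
    by (rule negligible_subset)
qed

text \<open>
  Differentiability at the single point \<open>z\<close> suffices, since values are only compared with the one at \<open>z\<close>.
\<close>

lemma injective_derivative_isolates:
  fixes f :: "'a::real_normed_vector \<Rightarrow> 'b::euclidean_space"
  assumes der: "(f has_derivative f') (at z)" and "inj f'"
  shows "\<forall>\<^sub>F w in at z. f w \<noteq> f z"
proof -
  obtain B where B: "0 < B" "\<And>x. B * norm x \<le> norm (f' x)"
    using linear_inj_bounded_below_pos[OF has_derivative_linear[OF der] assms(2)] by metis
  have "0 < B / 2" using B(1) by simp
  then obtain \<delta> where "0 < \<delta>"
    and \<delta>: "\<And>w. norm (w - z) < \<delta> \<Longrightarrow> norm (f w - f z - f' (w - z)) \<le> B / 2 * norm (w - z)"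
    using der unfolding has_derivative_at_alt by blast
  have "f w \<noteq> f z" if "w \<noteq> z" "dist w z < \<delta>" for w
  proof
    assume "f w = f z"
    then have "norm (f' (w - z)) \<le> B / 2 * norm (w - z)"
      using \<delta>[of w] that(2) by (simp add: dist_norm)
    then have "B * norm (w - z) \<le> B / 2 * norm (w - z)"
      using B(2)[of "w - z"] by linarith
    then show False
      using B(1) that(1) by simp
  qed
  then show ?thesis
    unfolding eventually_at using \<open>0 < \<delta>\<close> by blast
qed

lemma negligible_singular_values:
  fixes f :: "real^'n::{finite,wellorder} \<Rightarrow> real^'n::{finite,wellorder}"
  assumes "\<And>z. z \<in> S \<Longrightarrow> f differentiable (at z)"
  shows "negligible (f ` {z \<in> S. \<not> inj (frechet_derivative f (at z))})"
proof (rule baby_Sard)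
  fix z assume z: "z \<in> {z \<in> S. \<not> inj (frechet_derivative f (at z))}"
  then have diff: "f differentiable (at z)" using assms by blast
  then show "(f has_derivative frechet_derivative f (at z)) (at z within {z \<in> S. \<not> inj (frechet_derivative f (at z))})"
    using frechet_derivative_works has_derivative_at_withinI by blast
  have "(*v) (matrix (frechet_derivative f (at z))) = frechet_derivative f (at z)"
    using linear_frechet_derivative[OF diff] by (simp add: matrix_works fun_eq_iff)
  then show "rank (matrix (frechet_derivative f (at z))) < CARD('n)"
    using z less_rank_noninjective[of "matrix (frechet_derivative f (at z))"] by auto
qed simp

text \<open>
  Off the chords parallel to an axis, the four equations of a double normal can be solved for the
  parameters; let \<open>C\<close> be the solution as a function of the four coordinates. The double normals of the curve with
  parameters \<open>c\<close> form the fibre of \<open>C\<close> over \<open>c\<close>, and the points of the fibre over a regular value are isolated. By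
  Sard's theorem, almost every \<open>c\<close> is a regular value.
\<close>

lemma negligible_not_slanted_isolated:
  "negligible {c. \<not> slanted_isolated (perturb_y c P) (perturb_x c Q)}"
proof -
  define x1 y1 x2 y2 where "x1 z = z $ 1" and "y1 z = z $ 2" and "x2 z = z $ 3" and "y2 z = z $ 4"
    for z :: "real^4"
  define u v where "u z = x2 z - x1 z" and "v z = y2 z - y1 z" for z
  \<comment> \<open>\<open>c2\<close> comes from the difference of the perpendicularity conditions; \<open>K\<close> and \<open>L\<close> are the right-hand sides of \<open>c1 v - c3 u = K\<close> and \<open>c1 u + c3 v = L\<close>.\<close>
  define c2 where "c2 z = - (u z * (poly (pderiv P) (y2 z) - poly (pderiv P) (y1 z))
     + v z * (poly (pderiv Q) (x2 z) - poly (pderiv Q) (x1 z))) / (2 * u z * v z)" for z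
  define K where "K z = poly Q (x2 z) - poly Q (x1 z) + c2 z * ((x2 z)\<^sup>2 - (x1 z)\<^sup>2)
     - (poly P (y2 z) - poly P (y1 z))" for z
  define L where "L z = - (u z * poly (pderiv P) (y1 z)
     + v z * (poly (pderiv Q) (x1 z) + 2 * c2 z * x1 z))" for z
  define c1 where "c1 z = (K z * v z + L z * u z) / ((u z)\<^sup>2 + (v z)\<^sup>2)" for z
  define c3 where "c3 z = (L z * v z - K z * u z) / ((u z)\<^sup>2 + (v z)\<^sup>2)" for z
  define C where "C z = vec4 (c1 z) (c2 z) (c3 z)
     (poly P (y1 z) + c1 z * y1 z - poly Q (x1 z) - c2 z * (x1 z)\<^sup>2 - c3 z * x1 z)" for z
  define S where "S = {z. u z \<noteq> 0 \<and> v z \<noteq> 0}"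
  have diff: "C differentiable (at z)" if "z \<in> S" for z
  proof -
    have 1: "x1 differentiable (at z)" "y1 differentiable (at z)" "x2 differentiable (at z)" "y2 differentiable (at z)"
      unfolding x1_def y1_def x2_def y2_def by (intro derivative_intros)+
    then have 2: "u differentiable (at z)" "v differentiable (at z)"
      unfolding u_def v_def by (intro derivative_intros; simp)+
    have ne: "u z \<noteq> 0" "v z \<noteq> 0" "(u z)\<^sup>2 + (v z)\<^sup>2 \<noteq> 0"
      using that by (auto simp: S_def sum_power2_eq_zero_iff)
    have 3: "c2 differentiable (at z)"
      unfolding c2_def by (intro derivative_intros 1 2) (use ne in auto)
    have 4: "K differentiable (at z)" "L differentiable (at z)"
      unfolding K_def L_def by (intro derivative_intros 1 2 3)+
    have 5: "c1 differentiable (at z)" "c3 differentiable (at z)"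
      unfolding c1_def c3_def by (intro derivative_intros 2 4 ne(3))+
    show ?thesis
      unfolding C_def by (intro derivative_intros 1 3 5)
  qed
  have solve: "C (vec4 X1 Y1 X2 Y2) = c"
    if dn: "double_normal (perturb_y c P) (perturb_x c Q) X1 Y1 X2 Y2" and ne: "X1 \<noteq> X2" "Y1 \<noteq> Y2"
    for c X1 Y1 X2 Y2
  proof -
    define z where "z = vec4 X1 Y1 X2 Y2"
    have [simp]: "x1 z = X1" "y1 z = Y1" "x2 z = X2" "y2 z = Y2"
      by (simp_all add: x1_def y1_def x2_def y2_def z_def)
    define U V where "U = X2 - X1" and "V = Y2 - Y1"
    have [simp]: "u z = U" "v z = V"
      by (simp_all add: u_def v_def U_def V_def)
    have UV: "U \<noteq> 0" "V \<noteq> 0" "U\<^sup>2 + V\<^sup>2 \<noteq> 0"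
      using ne by (auto simp: U_def V_def sum_power2_eq_zero_iff)
    have on1: "poly P Y1 + c $ 1 * Y1 = poly Q X1 + c $ 2 * X1\<^sup>2 + c $ 3 * X1 + c $ 4"
      and on2: "poly P Y2 + c $ 1 * Y2 = poly Q X2 + c $ 2 * X2\<^sup>2 + c $ 3 * X2 + c $ 4"
      and n1: "U * (poly (pderiv P) Y1 + c $ 1) + V * (poly (pderiv Q) X1 + 2 * c $ 2 * X1 + c $ 3) = 0"
      and n2: "U * (poly (pderiv P) Y2 + c $ 1) + V * (poly (pderiv Q) X2 + 2 * c $ 2 * X2 + c $ 3) = 0"
      using dn by (simp_all add: double_normal_def poly_perturb U_def V_def)
    have "U * (poly (pderiv P) Y2 - poly (pderiv P) Y1) + V * (poly (pderiv Q) X2 - poly (pderiv Q) X1)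
        = - (c $ 2 * (2 * U * V))"
      using n1 n2 unfolding U_def V_def by algebra
    then have C2: "c2 z = c $ 2"
      using UV by (simp add: c2_def)
    have K: "K z = c $ 1 * V - c $ 3 * U"
      using on1 on2 by (simp add: K_def C2 U_def V_def algebra_simps)
    have L: "L z = c $ 1 * U + c $ 3 * V"
      using n1 by (simp add: L_def C2 algebra_simps)
    have C1: "c1 z = c $ 1"
    proof -
      have "K z * V + L z * U = c $ 1 * (U\<^sup>2 + V\<^sup>2)"
        unfolding K L by algebra
      then show ?thesis using UV(3) by (simp add: c1_def)
    qed
    have C3: "c3 z = c $ 3"
    proof -
      have "L z * V - K z * U = c $ 3 * (U\<^sup>2 + V\<^sup>2)"
        unfolding K L by algebra
      then show ?thesis using UV(3) by (simp add: c3_def)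
    qed
    have "c = C z"
      unfolding C_def vec4_eq_iff using C1 C2 C3 on1 by simp
    then show ?thesis by (simp add: z_def)
  qed
  have "{c. \<not> slanted_isolated (perturb_y c P) (perturb_x c Q)} \<subseteq>
      C ` {z \<in> S. \<not> inj (frechet_derivative C (at z))}"
  proof
    fix c assume "c \<in> {c. \<not> slanted_isolated (perturb_y c P) (perturb_x c Q)}"
    then obtain X1 Y1 X2 Y2 where ne: "X1 \<noteq> X2" "Y1 \<noteq> Y2"
      and limpt: "(X1, Y1, X2, Y2) islimpt
        {(x1, y1, x2, y2). double_normal (perturb_y c P) (perturb_x c Q) x1 y1 x2 y2}" (is "?l islimpt ?D")
      unfolding slanted_isolated_def by blast
    obtain g where g: "\<And>k. g k \<in> ?D - {?l}" and lim: "g \<longlonglongrightarrow> ?l"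
      using iffD1[OF islimpt_sequential limpt] by blast
    define \<phi> where "\<phi> p = vec4 (fst p) (fst (snd p)) (fst (snd (snd p))) (snd (snd (snd p)))" for p
    define z where "z = \<phi> ?l"
    have \<phi>_lim: "(\<lambda>k. \<phi> (g k)) \<longlonglongrightarrow> z"
      unfolding z_def \<phi>_def by (intro tendsto_intros lim)
    have ne_z: "\<phi> (g k) \<noteq> z" for k
      using g[of k] by (cases "g k") (auto simp: z_def \<phi>_def vec4_eq_iff)
    have at: "filterlim (\<lambda>k. \<phi> (g k)) (at z) sequentially"
      using \<phi>_lim ne_z by (simp add: filterlim_at)
    have z_S: "z \<in> S"
      using ne by (simp add: S_def z_def \<phi>_def u_def v_def x1_def y1_def x2_def y2_def)
    have "\<forall>\<^sub>F k in sequentially. fst (g k) - fst (snd (snd (g k))) \<noteq> 0"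
      by (rule tendsto_imp_eventually_ne[of _ "X1 - X2"])
        (use ne in \<open>auto intro!: tendsto_eq_intros lim\<close>)
    moreover have "\<forall>\<^sub>F k in sequentially. fst (snd (g k)) - snd (snd (snd (g k))) \<noteq> 0"
      by (rule tendsto_imp_eventually_ne[of _ "Y1 - Y2"])
        (use ne in \<open>auto intro!: tendsto_eq_intros lim\<close>)
    ultimately have C_c: "\<forall>\<^sub>F k in sequentially. C (\<phi> (g k)) = c"
    proof eventually_elim
      case (elim k)
      then show ?case
        using g[of k] solve by (cases "g k") (auto simp: \<phi>_def)
    qed
    have "isCont C z"
      using diff[OF z_S] differentiable_imp_continuous_within by blast
    then have "(\<lambda>k. C (\<phi> (g k))) \<longlonglongrightarrow> C z"
      using \<phi>_lim by (rule isCont_tendsto_compose)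
    moreover have "(\<lambda>k. C (\<phi> (g k))) \<longlonglongrightarrow> c"
      using C_c by (rule tendsto_eventually)
    ultimately have Cz: "C z = c"
      by (rule LIMSEQ_unique)
    have "\<not> inj (frechet_derivative C (at z))"
    proof
      assume inj: "inj (frechet_derivative C (at z))"
      have "(C has_derivative frechet_derivative C (at z)) (at z)"
        using diff[OF z_S] frechet_derivative_works by blast
      then have "\<forall>\<^sub>F w in at z. C w \<noteq> C z"
        using inj by (rule injective_derivative_isolates)
      then have "\<forall>\<^sub>F k in sequentially. C (\<phi> (g k)) \<noteq> C z"
        using at by (rule eventually_compose_filterlim)
      with C_c have "\<forall>\<^sub>F k in sequentially. False"
        by eventually_elim (simp add: Cz)
      then show False by simp
    qed
    then show "c \<in> C ` {z \<in> S. \<not> inj (frechet_derivative C (at z))}"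
      using Cz z_S by blast
  qed
  then show ?thesis
    using negligible_singular_values[of S C] diff negligible_subset by blast
qed

lemma negligible_infinite_double_normals:
  assumes "2 \<le> d" "degree P = d"
  shows "negligible {c. degree (perturb_x c Q) = d \<and>
     \<not> (smooth_curve (perturb_y c P) (perturb_x c Q) \<and>
        finite {(x1, y1, x2, y2). double_normal (perturb_y c P) (perturb_x c Q) x1 y1 x2 y2})}"
proof -
  let ?B1 = "{c. \<not> smooth_curve (perturb_y c P) (perturb_x c Q)}"
  let ?B2 = "{c. degenerate_horizontal (perturb_y c P) (perturb_x c Q)}"
  let ?B3 = "{c. degenerate_horizontal (perturb_x c Q) (perturb_y c P)}"
  let ?B4 = "{c. \<not> slanted_isolated (perturb_y c P) (perturb_x c Q)}"
  have neg: "negligible (?B1 \<union> (?B2 \<union> (?B3 \<union> ?B4)))"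
    by (rule negligible_Un[OF negligible_singular negligible_Un[OF negligible_degenerate_horizontal
        negligible_Un[OF negligible_degenerate_vertical negligible_not_slanted_isolated]]])
  have fine: "finite {(x1, y1, x2, y2). double_normal (perturb_y c P) (perturb_x c Q) x1 y1 x2 y2}"
    if "degree (perturb_x c Q) = d" "c \<notin> ?B1" "c \<notin> ?B2" "c \<notin> ?B3" "c \<notin> ?B4" for c
  proof (rule finite_double_normals)
    show "degree (perturb_y c P) = d"
      using degree_perturb_y assms by simp
  qed (use that assms(1) in simp_all)
  show ?thesis
    by (rule negligible_subset[OF neg]) (use fine in blast)
qed

section \<open>Polynomials with many real turning points\<close>

text \<open>
  A double root \<open>a\<close> could be removed once without changing the set of roots, which would then
  exceed the degree of the quotient.
\<close>

lemma pderiv_nonzero_at_root_if_distinct_roots: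
  fixes p :: "real poly"
  assumes "card {x. poly p x = 0} = degree p" "p \<noteq> 0" "poly p a = 0"
  shows "poly (pderiv p) a \<noteq> 0"
proof
  assume der: "poly (pderiv p) a = 0"
  obtain q where q: "p = [:- a, 1:] * q"
    using assms(3) by (metis dvdE poly_eq_0_iff_dvd)
  have "poly (pderiv p) a = poly q a"
    unfolding q pderiv_mult by (simp add: pderiv_pCons)
  then have qa: "poly q a = 0" using der by simp
  have "q \<noteq> 0" using q assms(2) by auto
  have "{x. poly p x = 0} = {x. poly q x = 0}"
    using qa by (auto simp: q)
  moreover have "degree p = Suc (degree q)"
    unfolding q using \<open>q \<noteq> 0\<close> by (subst degree_mult_eq) auto
  ultimately show False
    using assms(1) card_poly_roots_bound[OF \<open>q \<noteq> 0\<close>] by simp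
qed

lemma pderiv_nonzero_at_listed_root:
  fixes p :: "real poly"
  assumes "inj_on f {..<degree p}" "\<And>k. k < degree p \<Longrightarrow> poly p (f k) = 0" "p \<noteq> 0" "k < degree p"
  shows "poly (pderiv p) (f k) \<noteq> 0"
proof (rule pderiv_nonzero_at_root_if_distinct_roots)
  have "f ` {..<degree p} \<subseteq> {x. poly p x = 0}"
    using assms(2) by auto
  then have "card (f ` {..<degree p}) \<le> card {x. poly p x = 0}"
    by (rule card_mono[OF poly_roots_finite[OF assms(3)]])
  then have "degree p \<le> card {x. poly p x = 0}"
    by (simp add: card_image[OF assms(1)])
  then show "card {x. poly p x = 0} = degree p"
    using card_poly_roots_bound[OF assms(3)] by simp
qed (use assms in auto)

text \<open>
  The roots \<open>4\<^sup>k\<close> are chosen for the self-similarity \<open>y \<mapsto> 4 y\<close>, which compares the extrema between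
  consecutive roots and shows that they grow. In particular the critical values are distinct.
\<close>

definition geometric_poly :: "nat \<Rightarrow> real poly" where
  "geometric_poly d = (\<Prod>k<d. [:- (4 ^ k), 1:])"

lemma degree_geometric_poly [simp]: "degree (geometric_poly d) = d"
  unfolding geometric_poly_def by (subst degree_prod_eq_sum_degree) auto

lemma poly_geometric_poly: "poly (geometric_poly d) y = (\<Prod>k<d. y - 4 ^ k)"
  by (simp add: geometric_poly_def poly_prod algebra_simps)

lemma geometric_poly_grows:
  assumes "Suc k < d" "y \<in> {4 ^ k .. 4 ^ Suc k}"
  shows "3 * \<bar>poly (geometric_poly d) y\<bar> \<le> \<bar>poly (geometric_poly d) (4 * y)\<bar>"
proof -
  obtain n where d: "d = Suc n" using assms(1) by (cases d) auto
  have "1 \<le> (4::real) ^ k" by simp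
  also have "\<dots> \<le> y" using assms(2) by simp
  finally have y: "1 \<le> y" .
  have "y \<le> 4 ^ n"
    using assms power_increasing[of "Suc k" n "4::real"] d by fastforce
  then have "3 * \<bar>y - 4 ^ n\<bar> \<le> 3 * 4 ^ n"
    using y by simp
  also have "\<dots> \<le> \<bar>4 * y - 1\<bar> * 4 ^ n"
    using y by (intro mult_right_mono) auto
  finally have main: "3 * \<bar>y - 4 ^ n\<bar> \<le> \<bar>4 * y - 1\<bar> * 4 ^ n" .
  \<comment> \<open>Multiplication by 4 shifts the roots by one: the factor of the largest root is lost, the factor \<open>4 y - 1\<close> is gained, and each remaining one is multiplied by 4.\<close>
  have "(\<Prod>k<d. 4 * y - 4 ^ k) = (4 * y - 1) * (\<Prod>k<n. 4 * (y - 4 ^ k))"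
    unfolding d by (subst prod.lessThan_Suc_shift) (simp add: algebra_simps)
  also have "\<dots> = (4 * y - 1) * 4 ^ n * (\<Prod>k<n. y - 4 ^ k)"
    unfolding prod.distrib by simp
  finally have "\<bar>poly (geometric_poly d) (4 * y)\<bar> = \<bar>4 * y - 1\<bar> * 4 ^ n * \<bar>\<Prod>k<n. y - 4 ^ k\<bar>"
    by (simp add: poly_geometric_poly abs_mult)
  also have "\<dots> \<ge> 3 * \<bar>y - 4 ^ n\<bar> * \<bar>\<Prod>k<n. y - 4 ^ k\<bar>"
    using main by (intro mult_right_mono) auto
  finally show ?thesis
    by (simp add: poly_geometric_poly d abs_mult mult_ac)
qed

text \<open>
  Take \<open>\<eta> k\<close> as a maximum of the absolute value between two consecutive roots. These points exhaust the
  roots of the derivative, which are therefore simple.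
\<close>

lemma geometric_poly_critical_points:
  obtains \<eta> where "\<And>k. Suc k < d \<Longrightarrow> poly (pderiv (geometric_poly d)) (\<eta> k) = 0"
    "\<And>k. Suc k < d \<Longrightarrow> poly (pderiv (pderiv (geometric_poly d))) (\<eta> k) \<noteq> 0"
    "inj_on (\<lambda>k. poly (geometric_poly d) (\<eta> k)) {k. Suc k < d}"
proof -
  let ?A = "geometric_poly d"
  have "\<exists>y \<in> {4 ^ k .. 4 ^ Suc k}. \<forall>z \<in> {4 ^ k .. 4 ^ Suc k}. \<bar>poly ?A z\<bar> \<le> \<bar>poly ?A y\<bar>" for k
    by (rule continuous_attains_sup) (auto intro!: continuous_intros)
  then obtain \<eta> where \<eta>: "\<And>k. \<eta> k \<in> {4 ^ k .. 4 ^ Suc k}"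
    and max: "\<And>k z. z \<in> {4 ^ k .. 4 ^ Suc k} \<Longrightarrow> \<bar>poly ?A z\<bar> \<le> \<bar>poly ?A (\<eta> k)\<bar>"
    by metis
  have pos: "poly ?A (\<eta> k) \<noteq> 0" if k: "Suc k < d" for k
  proof -
    \<comment> \<open>A point strictly between two roots shows that the maximum is not zero.\<close>
    have "2 * 4 ^ k \<noteq> (4::real) ^ i" for i
    proof
      assume "2 * 4 ^ k = (4::real) ^ i"
      then have "(2::real) ^ (2 * i) = 2 ^ Suc (2 * k)"
        by (simp add: power_mult del: power_inject_exp)
      then have "2 * i = Suc (2 * k)"
        by (subst (asm) power_inject_exp) auto
      then show False by presburger
    qed
    then have "poly ?A (2 * 4 ^ k) \<noteq> 0"
      by (simp add: poly_geometric_poly)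
    then show ?thesis
      using max[of "2 * 4 ^ k" k] by auto
  qed
  have inside: "4 ^ k < \<eta> k" "\<eta> k < 4 ^ Suc k" if k: "Suc k < d" for k
  proof -
    have "poly ?A (4 ^ k) = 0" "poly ?A (4 ^ Suc k) = 0"
      using k by (auto simp: poly_geometric_poly intro: bexI[of _ k] bexI[of _ "Suc k"])
    then have "\<eta> k \<noteq> 4 ^ k" "\<eta> k \<noteq> 4 ^ Suc k"
      using pos[OF k] by metis+
    then show "4 ^ k < \<eta> k" "\<eta> k < 4 ^ Suc k"
      using \<eta>[of k] by auto
  qed
  have crit: "poly (pderiv ?A) (\<eta> k) = 0" if k: "Suc k < d" for k
  proof -
    let ?e = "min (\<eta> k - 4 ^ k) (4 ^ Suc k - \<eta> k)"
    \<comment> \<open>The square of the polynomial is differentiable where its absolute value need not be.\<close>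
    have "poly (?A * ?A) z \<le> poly (?A * ?A) (\<eta> k)" if "\<bar>\<eta> k - z\<bar> < ?e" for z
    proof -
      have "\<bar>poly ?A z\<bar> \<le> \<bar>poly ?A (\<eta> k)\<bar>"
        using that by (intro max) (auto simp: abs_if split: if_splits)
      then show ?thesis
        by (simp add: abs_le_square_iff power2_eq_square)
    qed
    then have "poly (pderiv (?A * ?A)) (\<eta> k) = 0"
      using inside[OF k]
      by (intro DERIV_local_max[OF poly_DERIV[of "?A * ?A" "\<eta> k"], of ?e]) auto
    then show ?thesis
      using pos[OF k] by (simp add: pderiv_mult)
  qed
  have step: "\<bar>poly ?A (\<eta> k)\<bar> < \<bar>poly ?A (\<eta> (Suc k))\<bar>" if "Suc (Suc k) < d" for k
  proof -
    have "3 * \<bar>poly ?A (\<eta> k)\<bar> \<le> \<bar>poly ?A (4 * \<eta> k)\<bar>"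
      using geometric_poly_grows[OF _ \<eta>] that by simp
    also have "\<dots> \<le> \<bar>poly ?A (\<eta> (Suc k))\<bar>"
      by (rule max) (use \<eta>[of k] in auto)
    finally show ?thesis
      using pos[of k] that by auto
  qed
  have mono: "\<bar>poly ?A (\<eta> j)\<bar> < \<bar>poly ?A (\<eta> k)\<bar>" if "j < k" "Suc k < d" for j k
    using that
  proof (induction k)
    case (Suc k)
    then show ?case
      using step[of k] by (cases "j = k") (auto simp: less_Suc_eq)
  qed simp
  have inj: "inj_on (\<lambda>k. poly ?A (\<eta> k)) {k. Suc k < d}"
    by (rule linorder_inj_onI) (use mono in fastforce)+
  have "poly (pderiv (pderiv ?A)) (\<eta> k) \<noteq> 0" if k: "Suc k < d" for k
  proof (rule pderiv_nonzero_at_listed_root)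
    have sub: "i < degree (pderiv ?A) \<Longrightarrow> Suc i < d" for i
      by (simp add: degree_pderiv)
    show "inj_on \<eta> {..<degree (pderiv ?A)}"
      using inj sub by (auto simp: inj_on_def)
    show "poly (pderiv ?A) (\<eta> i) = 0" if "i < degree (pderiv ?A)" for i
      using crit sub that by blast
    show "pderiv ?A \<noteq> 0"
      using k by (auto simp: pderiv_eq_0_iff)
    show "k < degree (pderiv ?A)"
      using k by (simp add: degree_pderiv)
  qed
  then show ?thesis
    using that crit inj by blast
qed

definition arithmetic_poly :: "nat \<Rightarrow> real poly" where
  "arithmetic_poly d = (\<Prod>k<d. [:- real k, 1:])"

lemma degree_arithmetic_poly [simp]: "degree (arithmetic_poly d) = d"
  unfolding arithmetic_poly_def by (subst degree_prod_eq_sum_degree) auto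

lemma poly_arithmetic_poly: "poly (arithmetic_poly d) x = (\<Prod>k<d. x - real k)"
  by (simp add: arithmetic_poly_def poly_prod algebra_simps)

text \<open>
  Every factor has absolute value at least one half.
\<close>

lemma arithmetic_poly_large: "(1/2) ^ d \<le> \<bar>poly (arithmetic_poly d) (real j - 1/2)\<bar>"
proof -
  have "(\<Prod>k<d. 1/2) \<le> (\<Prod>k<d. \<bar>real j - 1/2 - real k\<bar>)"
  proof (rule prod_mono)
    fix k
    have "1 / 2 \<le> \<bar>real j - 1/2 - real k\<bar>"
    proof (cases "j \<le> k")
      case True
      then have "real j - 1/2 - real k \<le> - (1/2)" by simp
      then show ?thesis by linarith
    next
      case False
      then have "1 / 2 \<le> real j - 1/2 - real k" by linarith
      then show ?thesis by linarith
    qed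
    then show "0 \<le> (1/2::real) \<and> 1/2 \<le> \<bar>real j - 1/2 - real k\<bar>" by simp
  qed
  then show ?thesis
    by (simp add: poly_arithmetic_poly abs_prod)
qed

lemma arithmetic_poly_alternates:
  assumes "j < d"
  shows "poly (arithmetic_poly d) (real j - 1/2) * poly (arithmetic_poly d) (real j + 1/2) < 0"
proof -
  have "poly (arithmetic_poly d) (real j - 1/2) * poly (arithmetic_poly d) (real j + 1/2)
      = (\<Prod>k<d. (real j - 1/2 - real k) * (real j + 1/2 - real k))"
    by (simp add: poly_arithmetic_poly prod.distrib)
  also have "\<dots> = (real j - 1/2 - real j) * (real j + 1/2 - real j) *
      (\<Prod>k\<in>{..<d} - {j}. (real j - 1/2 - real k) * (real j + 1/2 - real k))"
    using assms by (intro prod.remove) auto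
  also have "\<dots> < 0"
  proof -
    have "0 < (real j - 1/2 - real k) * (real j + 1/2 - real k)" if "k \<noteq> j" for k
      using that by (cases "k < j") (auto intro!: mult_pos_pos mult_neg_neg)
    then have "0 < (\<Prod>k\<in>{..<d} - {j}. (real j - 1/2 - real k) * (real j + 1/2 - real k))"
      by (intro prod_pos) auto
    then show ?thesis by simp
  qed
  finally show ?thesis .
qed

text \<open>
  The scaling makes the polynomial exceed \<open>E\<close> in absolute value, with alternating signs, at the half-integers
  \<open>-1/2, 1/2, \<dots>, d - 1/2\<close>. So every value in \<open>[-E, E]\<close> is taken once in each of the \<open>d\<close> intervals between them.
\<close>

lemma scaled_arithmetic_poly_preimages:
  assumes "\<bar>e\<bar> \<le> E" and B: "B = smult ((E + 1) * 2 ^ d) (arithmetic_poly d)"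
  obtains \<xi> where "\<And>j. j < d \<Longrightarrow> \<xi> j \<in> {real j - 1/2 <..< real j + 1/2}"
    "\<And>j. j < d \<Longrightarrow> poly B (\<xi> j) = e" "\<And>j. j < d \<Longrightarrow> poly (pderiv B) (\<xi> j) \<noteq> 0"
proof -
  have E: "0 < E + 1" using assms(1) by linarith
  have large: "E + 1 \<le> \<bar>poly B (real j - 1/2)\<bar>" for j
  proof -
    have "(E + 1) * 2 ^ d * (1/2) ^ d \<le> (E + 1) * 2 ^ d * \<bar>poly (arithmetic_poly d) (real j - 1/2)\<bar>"
      using E by (intro mult_left_mono arithmetic_poly_large) auto
    then show ?thesis
      using E by (simp add: B abs_mult power_one_over)
  qed
  have large': "E + 1 \<le> \<bar>poly B (real j + 1/2)\<bar>" for j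
    using large[of "Suc j"] by (simp add: algebra_simps)
  have "\<exists>x. x \<in> {real j - 1/2 <..< real j + 1/2} \<and> poly B x = e" if j: "j < d" for j
  proof -
    have "poly B (real j - 1/2) * poly B (real j + 1/2) = ((E + 1) * 2 ^ d) ^ 2 *
      (poly (arithmetic_poly d) (real j - 1/2) * poly (arithmetic_poly d) (real j + 1/2))"
      by (simp add: B power2_eq_square mult_ac)
    also have "\<dots> < 0"
      by (rule mult_pos_neg[OF zero_less_power[OF mult_pos_pos] arithmetic_poly_alternates[OF j]])
        (use E in simp_all)
    finally have "poly B (real j - 1/2) < 0 \<and> 0 < poly B (real j + 1/2) \<or>
        0 < poly B (real j - 1/2) \<and> poly B (real j + 1/2) < 0"
      by (auto simp: mult_less_0_iff)
    then have "poly (B - [:e:]) (real j - 1/2) * poly (B - [:e:]) (real j + 1/2) < 0"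
      using large[of j] large'[of j] assms(1)
      by (auto simp: mult_less_0_iff)
    then show ?thesis
      using poly_IVT[of "real j - 1/2" "real j + 1/2" "B - [:e:]"] by auto
  qed
  then obtain \<xi> where \<xi>: "\<And>j. j < d \<Longrightarrow> \<xi> j \<in> {real j - 1/2 <..< real j + 1/2}"
    and eq: "\<And>j. j < d \<Longrightarrow> poly B (\<xi> j) = e"
    by metis
  have "poly (pderiv B) (\<xi> j) \<noteq> 0" if j: "j < d" for j
  proof -
    have deg: "degree (B - [:e:]) = d"
      unfolding diff_conv_add_uminus using E j by (subst degree_add_eq_left) (simp_all add: B)
    have inj: "inj_on \<xi> {..<d}"
    proof (rule linorder_inj_onI)
      fix i k assume "i < k" "i \<in> {..<d}" "k \<in> {..<d}"
      then show "\<xi> i \<noteq> \<xi> k"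
        using \<xi>[of i] \<xi>[of k] by auto
    qed auto
    have "poly (pderiv (B - [:e:])) (\<xi> j) \<noteq> 0"
      by (rule pderiv_nonzero_at_listed_root) (use deg inj eq j in auto)
    then show ?thesis
      by (simp add: pderiv_diff)
  qed
  then show ?thesis
    using that \<xi> eq by blast
qed

text \<open>
  The points of the curve \<open>A(y) = B(x)\<close> with a vertical tangent are the solutions of \<open>A'(y) = 0\<close>,
  \<open>B(x) = A(y)\<close>. There are at most \<open>(d - 1) d\<close> of them; here all are real. Abscissas of points at different heights
  differ because the critical values of \<open>A\<close> do.
\<close>

lemma exists_real_turning_points:
  fixes d :: nat
  assumes "1 \<le> d"
  obtains A B :: "real poly" and Z :: "(real \<times> real) set" where
    "degree A = d" "degree B = d" "finite Z" "card Z = d * (d - 1)" "inj_on fst Z"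
    "\<forall>x y. (x, y) \<in> Z \<longrightarrow> poly A y = poly B x \<and> poly (pderiv A) y = 0 \<and>
       poly (pderiv (pderiv A)) y \<noteq> 0 \<and> poly (pderiv B) x \<noteq> 0"
proof -
  define A where "A = geometric_poly d"
  obtain \<eta> where \<eta>: "\<And>k. Suc k < d \<Longrightarrow> poly (pderiv A) (\<eta> k) = 0"
    "\<And>k. Suc k < d \<Longrightarrow> poly (pderiv (pderiv A)) (\<eta> k) \<noteq> 0"
    "inj_on (\<lambda>k. poly A (\<eta> k)) {k. Suc k < d}"
    using geometric_poly_critical_points unfolding A_def by blast
  define E where "E = (\<Sum>k<d. \<bar>poly A (\<eta> k)\<bar>)"
  have E: "\<bar>poly A (\<eta> k)\<bar> \<le> E" if "k < d" for k
    unfolding E_def using that by (intro member_le_sum) auto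
  have "0 \<le> E" unfolding E_def by (intro sum_nonneg) auto
  define B where "B = smult ((E + 1) * 2 ^ d) (arithmetic_poly d)"
  have "\<forall>k. \<exists>\<xi>. k < d \<longrightarrow> (\<forall>j<d. \<xi> j \<in> {real j - 1/2 <..< real j + 1/2} \<and>
     poly B (\<xi> j) = poly A (\<eta> k) \<and> poly (pderiv B) (\<xi> j) \<noteq> 0)"
    using scaled_arithmetic_poly_preimages[OF E B_def] by metis
  then obtain \<xi> where \<xi>: "\<And>k j. k < d \<Longrightarrow> j < d \<Longrightarrow> \<xi> k j \<in> {real j - 1/2 <..< real j + 1/2} \<and>
     poly B (\<xi> k j) = poly A (\<eta> k) \<and> poly (pderiv B) (\<xi> k j) \<noteq> 0"
    by metis
  define Z where "Z = (\<lambda>(k, j). (\<xi> k j, \<eta> k)) ` ({..<d - 1} \<times> {..<d})"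
  have same: "k = k' \<and> j = j'" if "\<xi> k j = \<xi> k' j'" "Suc k < d" "Suc k' < d" "j < d" "j' < d" for k j k' j'
  proof -
    have "poly A (\<eta> k) = poly A (\<eta> k')"
      using \<xi>[of k j] \<xi>[of k' j'] that by simp
    then have k: "k = k'"
      using \<eta>(3) that by (auto simp: inj_on_def)
    have "\<xi> k j \<in> {real j - 1/2 <..< real j + 1/2}" "\<xi> k j \<in> {real j' - 1/2 <..< real j' + 1/2}"
      using \<xi>[of k j] \<xi>[of k' j'] that by auto
    then have "real j < real j' + 1" "real j' < real j + 1" by auto
    then show ?thesis using k by simp
  qed
  have inj: "inj_on (\<lambda>(k, j). (\<xi> k j, \<eta> k)) ({..<d - 1} \<times> {..<d})"
    using same by (auto simp: inj_on_def less_diff_conv)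
  show ?thesis
  proof (rule that[of A B Z])
    show "degree A = d" by (simp add: A_def)
    show "degree B = d" using \<open>0 \<le> E\<close> by (simp add: B_def)
    show "finite Z" by (simp add: Z_def)
    show "card Z = d * (d - 1)"
      unfolding Z_def card_image[OF inj] by (simp add: card_cartesian_product)
    show "inj_on fst Z"
    proof (rule inj_onI)
      fix p q assume pq: "p \<in> Z" "q \<in> Z" and eq: "fst p = fst q"
      obtain k j where p: "p = (\<xi> k j, \<eta> k)" "Suc k < d" "j < d"
        using pq(1) by (auto simp: Z_def less_diff_conv)
      obtain k' j' where q: "q = (\<xi> k' j', \<eta> k')" "Suc k' < d" "j' < d"
        using pq(2) by (auto simp: Z_def less_diff_conv)
      show "p = q"
        using same[of k j k' j'] eq p q by simp
    qed
    show "\<forall>x y. (x, y) \<in> Z \<longrightarrow> poly A y = poly B x \<and> poly (pderiv A) y = 0 \<and>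
       poly (pderiv (pderiv A)) y \<noteq> 0 \<and> poly (pderiv B) x \<noteq> 0"
      using \<xi> \<eta>(1,2) unfolding Z_def by (auto simp: less_diff_conv)
  qed
qed

section \<open>Diameters near pairs of turning points\<close>

text \<open>
  The map \<open>w \<mapsto> w - \<Phi> \<tau> w\<close> has zero derivative at \<open>z\<close> for \<open>\<tau> = 0\<close>, so it sends a small ball around \<open>z\<close> into
  the ball of half the radius, and for small \<open>\<tau>\<close> still into the ball itself. A fixed point,
  which Brouwer's theorem provides, is a zero of \<open>\<Phi> \<tau>\<close>.
\<close>

lemma persistent_zero:
  fixes \<Phi> :: "'p::euclidean_space \<Rightarrow> 'a::euclidean_space \<Rightarrow> 'a"
  assumes cont: "continuous_on UNIV (\<lambda>p. \<Phi> (fst p) (snd p))"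
    and der: "(\<Phi> 0 has_derivative (\<lambda>h. h)) (at z)" and zero: "\<Phi> 0 z = 0" and "0 < \<rho>"
  shows "\<forall>\<^sub>F \<tau> in nhds 0. \<exists>w \<in> cball z \<rho>. \<Phi> \<tau> w = 0"
proof -
  obtain \<delta> where "0 < \<delta>"
    and \<delta>: "\<And>w. norm (w - z) < \<delta> \<Longrightarrow> norm (\<Phi> 0 w - \<Phi> 0 z - (w - z)) \<le> 1/2 * norm (w - z)"
    using der unfolding has_derivative_at_alt by (metis half_gt_zero_iff zero_less_one)
  define r where "r = min \<rho> (\<delta> / 2)"
  have r: "0 < r" "r \<le> \<rho>" "r < \<delta>"
    using \<open>0 < \<rho>\<close> \<open>0 < \<delta>\<close> by (auto simp: r_def)
  have "compact (cball (0::'p) 1 \<times> cball z r)"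
    by (intro compact_Times compact_cball)
  then have "uniformly_continuous_on (cball (0::'p) 1 \<times> cball z r) (\<lambda>p. \<Phi> (fst p) (snd p))"
    by (intro compact_uniformly_continuous continuous_on_subset[OF cont]) auto
  then obtain e where "0 < e"
    and e: "\<And>p q. p \<in> cball 0 1 \<times> cball z r \<Longrightarrow> q \<in> cball 0 1 \<times> cball z r \<Longrightarrow> dist q p < e \<Longrightarrow>
      dist (\<Phi> (fst q) (snd q)) (\<Phi> (fst p) (snd p)) < r / 2"
    using r(1) unfolding uniformly_continuous_on_def by (metis half_gt_zero)
  have "\<exists>w \<in> cball z \<rho>. \<Phi> \<tau> w = 0" if \<tau>: "dist \<tau> 0 < min e 1" for \<tau>
  proof -
    define g where "g w = w - \<Phi> \<tau> w" for w
    have "continuous_on (cball z r) (\<lambda>w. \<Phi> (fst (\<tau>, w)) (snd (\<tau>, w)))"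
      by (rule continuous_on_compose2[OF cont]) (auto intro!: continuous_intros)
    then have "continuous_on (cball z r) g"
      unfolding g_def by (auto intro!: continuous_intros)
    moreover have "g \<in> cball z r \<rightarrow> cball z r"
    proof
      fix w assume w: "w \<in> cball z r"
      have "norm (\<Phi> 0 w - (w - z)) \<le> 1/2 * norm (w - z)"
        using \<delta>[of w] w r(3) zero by (simp add: dist_norm norm_minus_commute)
      also have "\<dots> \<le> r / 2"
        using w by (simp add: dist_norm norm_minus_commute)
      finally have 1: "norm (\<Phi> 0 w - (w - z)) \<le> r / 2" .
      have "dist (\<Phi> \<tau> w) (\<Phi> 0 w) < r / 2"
        using e[of "(0, w)" "(\<tau>, w)"] w \<tau> by (simp add: dist_Pair_Pair dist_commute)
      then have 2: "norm (\<Phi> \<tau> w - \<Phi> 0 w) < r / 2"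
        by (simp add: dist_norm)
      have "norm (g w - z) = norm ((\<Phi> 0 w - (w - z)) + (\<Phi> \<tau> w - \<Phi> 0 w))"
        unfolding g_def by (subst norm_minus_cancel[symmetric]) (simp add: algebra_simps)
      also have "\<dots> \<le> r / 2 + r / 2"
        using norm_triangle_ineq[of "\<Phi> 0 w - (w - z)" "\<Phi> \<tau> w - \<Phi> 0 w"] 1 2 by linarith
      finally show "g w \<in> cball z r"
        by (simp add: dist_norm norm_minus_commute)
    qed
    ultimately obtain w where "w \<in> cball z r" "g w = w"
      using brouwer_ball r(1) by blast
    then show ?thesis
      using r(2) by (auto simp: g_def)
  qed
  then show ?thesis
    unfolding eventually_nhds_metric using \<open>0 < e\<close>
    by (intro exI[of _ "min e 1"] conjI allI impI) simp_all
qed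

text \<open>
  For the parameter \<open>\<tau> = (s\<^sup>2, c)\<close> the equations say that \<open>(X1, s Y1)\<close> and \<open>(X2, s Y2)\<close> are the ends of a
  diameter of the perturbed curve after the vertical scale has been multiplied by \<open>s\<close>. At \<open>\<tau> = 0\<close> the
  perpendicularity conditions reduce to \<open>A'(Y1) = A'(Y2) = 0\<close>, and the pair of turning points is a solution. The
  derivative of the system is diagonal there, with the entries \<open>B'(x)\<close> and \<open>(x2 - x1) A''(y)\<close>, and none of them
  vanishes.
\<close>

lemma turning_pair_persists:
  assumes A: "poly (pderiv A) y1 = 0" "poly (pderiv A) y2 = 0"
      "poly (pderiv (pderiv A)) y1 \<noteq> 0" "poly (pderiv (pderiv A)) y2 \<noteq> 0"
    and B: "poly (pderiv B) x1 \<noteq> 0" "poly (pderiv B) x2 \<noteq> 0"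
    and on: "poly A y1 = poly B x1" "poly A y2 = poly B x2"
    and ne: "x1 \<noteq> x2" and "0 < \<rho>"
  shows "\<forall>\<^sub>F \<tau> in nhds (0::real \<times> (real^4)). \<exists>X1 Y1 X2 Y2. \<bar>X1 - x1\<bar> \<le> \<rho> \<and> \<bar>X2 - x2\<bar> \<le> \<rho> \<and>
     poly (perturb_y (snd \<tau>) A) Y1 = poly (perturb_x (snd \<tau>) B) X1 \<and>
     poly (perturb_y (snd \<tau>) A) Y2 = poly (perturb_x (snd \<tau>) B) X2 \<and>
     (X2 - X1) * poly (pderiv (perturb_y (snd \<tau>) A)) Y1
       + fst \<tau> * (Y2 - Y1) * poly (pderiv (perturb_x (snd \<tau>) B)) X1 = 0 \<and>
     (X2 - X1) * poly (pderiv (perturb_y (snd \<tau>) A)) Y2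
       + fst \<tau> * (Y2 - Y1) * poly (pderiv (perturb_x (snd \<tau>) B)) X2 = 0"
proof -
  define on_curve where "on_curve \<tau> x y = poly B x + snd \<tau> $ 2 * x\<^sup>2 + snd \<tau> $ 3 * x + snd \<tau> $ 4
      - (poly A y + snd \<tau> $ 1 * y)" for \<tau> :: "real \<times> (real^4)" and x y
  define normal where "normal \<tau> u v x y = u * (poly (pderiv A) y + snd \<tau> $ 1)
      + fst \<tau> * v * (poly (pderiv B) x + 2 * snd \<tau> $ 2 * x + snd \<tau> $ 3)" for \<tau> :: "real \<times> (real^4)" and u v x y
  define \<beta>1 \<beta>2 \<alpha>1 \<alpha>2 where "\<beta>1 = poly (pderiv B) x1" and "\<beta>2 = poly (pderiv B) x2"
    and "\<alpha>1 = (x2 - x1) * poly (pderiv (pderiv A)) y1"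
    and "\<alpha>2 = (x2 - x1) * poly (pderiv (pderiv A)) y2"
  have nz: "\<beta>1 \<noteq> 0" "\<beta>2 \<noteq> 0" "\<alpha>1 \<noteq> 0" "\<alpha>2 \<noteq> 0"
    using A B ne by (simp_all add: \<beta>1_def \<beta>2_def \<alpha>1_def \<alpha>2_def)
  \<comment> \<open>Dividing by the diagonal entries turns the derivative at \<open>z\<close> into the identity.\<close>
  define \<Phi> where "\<Phi> \<tau> z = vec4
     (on_curve \<tau> (z $ 1) (z $ 2) / \<beta>1)
     (normal \<tau> (z $ 3 - z $ 1) (z $ 4 - z $ 2) (z $ 1) (z $ 2) / \<alpha>1)
     (on_curve \<tau> (z $ 3) (z $ 4) / \<beta>2)
     (normal \<tau> (z $ 3 - z $ 1) (z $ 4 - z $ 2) (z $ 3) (z $ 4) / \<alpha>2)" for \<tau> :: "real \<times> (real^4)" and z :: "real^4"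
  define z where "z = vec4 x1 y1 x2 y2"
  have "\<forall>\<^sub>F \<tau> in nhds 0. \<exists>w \<in> cball z \<rho>. \<Phi> \<tau> w = 0"
  proof (rule persistent_zero)
    show "continuous_on UNIV (\<lambda>p. \<Phi> (fst p) (snd p))"
      unfolding \<Phi>_def on_curve_def normal_def by (intro continuous_intros) (use nz in auto)
    show "\<Phi> 0 z = 0"
      by (simp add: \<Phi>_def on_curve_def normal_def z_def on A vec_eq_iff forall_4)
    show "0 < \<rho>" by fact
    have coord: "((\<lambda>w. w $ i) has_derivative (\<lambda>h. h $ i)) (at z)" for i
      by (rule bounded_linear.has_derivative[OF bounded_linear_vec_nth has_derivative_ident])
    have onc: "((\<lambda>w. on_curve 0 (w $ i) (w $ j) / poly (pderiv B) (z $ i)) has_derivative (\<lambda>h. h $ i)) (at z)"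
      if "poly (pderiv B) (z $ i) \<noteq> 0" "poly (pderiv A) (z $ j) = 0" for i j
    proof -
      have "((\<lambda>w. (poly B (w $ i) - poly A (w $ j)) * inverse (poly (pderiv B) (z $ i))) has_derivative
        (\<lambda>h. (poly (pderiv B) (z $ i) * h $ i - poly (pderiv A) (z $ j) * h $ j)
          * inverse (poly (pderiv B) (z $ i)))) (at z)"
        by (intro has_derivative_mult_left has_derivative_diff has_derivative_poly coord)
      moreover have "(\<lambda>h. (poly (pderiv B) (z $ i) * h $ i - poly (pderiv A) (z $ j) * h $ j)
          * inverse (poly (pderiv B) (z $ i))) = (\<lambda>h. h $ i)"
        using that by (simp add: fun_eq_iff)
      ultimately show ?thesis
        by (simp add: on_curve_def divide_inverse)
    qed
    have nrm: "((\<lambda>w. normal 0 (w $ 3 - w $ 1) (w $ 4 - w $ 2) (w $ i) (w $ j)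
         / ((x2 - x1) * poly (pderiv (pderiv A)) (z $ j))) has_derivative (\<lambda>h. h $ j)) (at z)"
      if "poly (pderiv (pderiv A)) (z $ j) \<noteq> 0" "poly (pderiv A) (z $ j) = 0" for i j
    proof -
      have "((\<lambda>w. (w $ 3 - w $ 1) * poly (pderiv A) (w $ j)
          * inverse ((x2 - x1) * poly (pderiv (pderiv A)) (z $ j))) has_derivative
        (\<lambda>h. ((z $ 3 - z $ 1) * (poly (pderiv (pderiv A)) (z $ j) * h $ j)
          + (h $ 3 - h $ 1) * poly (pderiv A) (z $ j))
          * inverse ((x2 - x1) * poly (pderiv (pderiv A)) (z $ j)))) (at z)"
        by (intro has_derivative_mult_left has_derivative_mult has_derivative_diff
            has_derivative_poly coord)
      moreover have "(\<lambda>h. ((z $ 3 - z $ 1) * (poly (pderiv (pderiv A)) (z $ j) * h $ j)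
          + (h $ 3 - h $ 1) * poly (pderiv A) (z $ j))
          * inverse ((x2 - x1) * poly (pderiv (pderiv A)) (z $ j))) = (\<lambda>h. h $ j)"
        using that ne by (simp add: fun_eq_iff z_def field_simps)
      ultimately show ?thesis
        by (simp add: normal_def divide_inverse)
    qed
    have "(\<Phi> 0 has_derivative (\<lambda>h. vec4 (h $ 1) (h $ 2) (h $ 3) (h $ 4))) (at z)"
      unfolding \<Phi>_def \<beta>1_def \<beta>2_def \<alpha>1_def \<alpha>2_def
      using onc[of 1 2] onc[of 3 4] nrm[of 2 1] nrm[of 4 3] A B
      by (intro has_derivative_vec4) (simp_all add: z_def)
    moreover have "(\<lambda>h::real^4. vec4 (h $ 1) (h $ 2) (h $ 3) (h $ 4)) = (\<lambda>h. h)"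
      by (simp add: fun_eq_iff vec_eq_iff forall_4)
    ultimately show "(\<Phi> 0 has_derivative (\<lambda>h. h)) (at z)"
      by simp
  qed
  then show ?thesis
  proof eventually_elim
    case (elim \<tau>)
    then obtain w where w: "dist z w \<le> \<rho>" and zero: "\<Phi> \<tau> w = 0"
      by auto
    have "\<bar>w $ i - z $ i\<bar> \<le> \<rho>" for i
      using order_trans[OF component_le_norm_cart[of "w - z" i]] w by (simp add: dist_norm norm_minus_commute)
    from this[of 1] this[of 3] have near: "\<bar>w $ 1 - x1\<bar> \<le> \<rho>" "\<bar>w $ 3 - x2\<bar> \<le> \<rho>"
      by (simp_all add: z_def)
    have "on_curve \<tau> (w $ 1) (w $ 2) = 0" "on_curve \<tau> (w $ 3) (w $ 4) = 0"
      "normal \<tau> (w $ 3 - w $ 1) (w $ 4 - w $ 2) (w $ 1) (w $ 2) = 0"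
      "normal \<tau> (w $ 3 - w $ 1) (w $ 4 - w $ 2) (w $ 3) (w $ 4) = 0"
      using zero nz by (simp_all add: \<Phi>_def vec_eq_iff forall_4)
    then show ?case
      unfolding poly_perturb using near
      by (intro exI[of _ "w $ 1"] exI[of _ "w $ 2"] exI[of _ "w $ 3"] exI[of _ "w $ 4"])
        (simp add: on_curve_def normal_def)
  qed
qed

definition stretch :: "real \<Rightarrow> real poly \<Rightarrow> real poly" where
  "stretch s A = pcompose A [:0, 1 / s:]"

lemma poly_stretch:
  assumes "s \<noteq> 0"
  shows "poly (stretch s A) (s * y) = poly A y"
    "poly (pderiv (stretch s A)) (s * y) = poly (pderiv A) y / s"
  using assms by (simp_all add: stretch_def poly_pcompose pderiv_pcompose pderiv_pCons)

lemma degree_stretch: "s \<noteq> 0 \<Longrightarrow> degree (stretch s A) = degree A"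
  by (simp add: stretch_def degree_pcompose)

text \<open>
  The parameter \<open>c\<close> perturbs the stretched curve, where the monomial \<open>y\<close> is \<open>s\<close> times the old ordinate; hence the
  factor \<open>s\<close> in the first entry of \<open>c'\<close>.
\<close>

lemma double_normal_stretch:
  assumes "0 < s" "X1 \<noteq> X2"
    and c': "c' = vec4 (s * c $ 1) (c $ 2) (c $ 3) (c $ 4)"
    and "poly (perturb_y c' A) Y1 = poly (perturb_x c' B) X1"
      "poly (perturb_y c' A) Y2 = poly (perturb_x c' B) X2"
      "(X2 - X1) * poly (pderiv (perturb_y c' A)) Y1
       + s\<^sup>2 * (Y2 - Y1) * poly (pderiv (perturb_x c' B)) X1 = 0"
      "(X2 - X1) * poly (pderiv (perturb_y c' A)) Y2
       + s\<^sup>2 * (Y2 - Y1) * poly (pderiv (perturb_x c' B)) X2 = 0"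
  shows "double_normal (perturb_y c (stretch s A)) (perturb_x c B) X1 (s * Y1) X2 (s * Y2)"
proof -
  have scale: "u * (a / s + k) + (s * Y2 - s * Y1) * b = 0"
    if "u * (a + s * k) + s\<^sup>2 * (Y2 - Y1) * b = 0" for u a k b
  proof -
    have "s * (u * (a / s + k) + (s * Y2 - s * Y1) * b) = u * (a + s * k) + s\<^sup>2 * (Y2 - Y1) * b"
      using assms(1) by (simp add: field_simps power2_eq_square)
    then show ?thesis
      using that assms(1) by simp
  qed
  have s: "s \<noteq> 0" using assms(1) by simp
  note eqs = assms(4-)[unfolded poly_perturb c' vec4_nth]
  show ?thesis
    unfolding double_normal_def poly_perturb poly_stretch[OF s]
  proof (intro conjI)
    show "poly A Y1 + c $ 1 * (s * Y1) = poly B X1 + c $ 2 * X1\<^sup>2 + c $ 3 * X1 + c $ 4"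
      using eqs(1) by (simp add: mult_ac)
    show "poly A Y2 + c $ 1 * (s * Y2) = poly B X2 + c $ 2 * X2\<^sup>2 + c $ 3 * X2 + c $ 4"
      using eqs(2) by (simp add: mult_ac)
    show "(X1, s * Y1) \<noteq> (X2, s * Y2)"
      using assms(2) by simp
  qed (rule scale[OF eqs(3)], rule scale[OF eqs(4)])
qed

text \<open>
  Choose \<open>s\<close> so small that all pairs of turning points persist for all small \<open>c\<close>, and only then a generic
  small \<open>c\<close>, for which the number of diameters is finite. A pair of turning points can be recovered from
  its diameter by looking for turning points near the ends, so different pairs give different diameters.
\<close>

lemma exists_curve_with_many_diameters:
  fixes d :: nat
  assumes "2 \<le> d"
  obtains f where "algebraic_curve d f" "\<not> has_circle_component f" "finite (diameters f)"
    "d * (d - 1) choose 2 \<le> card (diameters f)"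
proof -
  have "1 \<le> d" using assms by simp
  then obtain A B :: "real poly" and Z where deg: "degree A = d" "degree B = d"
    and Z: "finite Z" "card Z = d * (d - 1)" "inj_on fst Z"
    and turning: "\<forall>x y. (x, y) \<in> Z \<longrightarrow> poly A y = poly B x \<and> poly (pderiv A) y = 0 \<and>
       poly (pderiv (pderiv A)) y \<noteq> 0 \<and> poly (pderiv B) x \<noteq> 0"
    by (rule exists_real_turning_points)
  \<comment> \<open>For small \<open>\<rho>\<close>, the neighbourhoods of radius \<open>\<rho>\<close> of the abscissas of the turning points are disjoint.\<close>
  have "\<forall>\<^sub>F \<rho> in at_right (0::real). \<forall>p \<in> Z \<times> Z. fst (fst p) \<noteq> fst (snd p) \<longrightarrow>
      2 * \<rho> < \<bar>fst (fst p) - fst (snd p)\<bar>"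
  proof (intro eventually_ball_finite finite_cartesian_product Z(1) ballI)
    fix p :: "(real \<times> real) \<times> real \<times> real"
    show "\<forall>\<^sub>F \<rho> in at_right 0. fst (fst p) \<noteq> fst (snd p) \<longrightarrow> 2 * \<rho> < \<bar>fst (fst p) - fst (snd p)\<bar>"
    proof (cases "fst (fst p) = fst (snd p)")
      case False
      then have "\<forall>\<^sub>F \<rho> in at_right 0. \<rho> < \<bar>fst (fst p) - fst (snd p)\<bar> / 2"
        by (intro order_tendstoD(2)[OF tendsto_ident_at]) simp
      then show ?thesis
        by eventually_elim auto
    qed simp
  qed
  then obtain \<rho> where "0 < \<rho>" and gaps: "\<forall>p \<in> Z \<times> Z. fst (fst p) \<noteq> fst (snd p) \<longrightarrow>
      2 * \<rho> < \<bar>fst (fst p) - fst (snd p)\<bar>"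
    using eventually_happens'[OF trivial_limit_at_right_real
        eventually_conj[OF eventually_at_right_less[of "0::real"]]] by blast
  have \<rho>: "2 * \<rho> < \<bar>fst z - fst w\<bar>" if "z \<in> Z" "w \<in> Z" "fst z \<noteq> fst w" for z w
    using bspec[OF gaps, of "(z, w)"] that by simp
  define good where "good \<tau> x1 x2 X1 Y1 X2 Y2 \<longleftrightarrow> \<bar>X1 - x1\<bar> \<le> \<rho> \<and> \<bar>X2 - x2\<bar> \<le> \<rho> \<and>
     poly (perturb_y (snd \<tau>) A) Y1 = poly (perturb_x (snd \<tau>) B) X1 \<and>
     poly (perturb_y (snd \<tau>) A) Y2 = poly (perturb_x (snd \<tau>) B) X2 \<and>
     (X2 - X1) * poly (pderiv (perturb_y (snd \<tau>) A)) Y1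
       + fst \<tau> * (Y2 - Y1) * poly (pderiv (perturb_x (snd \<tau>) B)) X1 = 0 \<and>
     (X2 - X1) * poly (pderiv (perturb_y (snd \<tau>) A)) Y2
       + fst \<tau> * (Y2 - Y1) * poly (pderiv (perturb_x (snd \<tau>) B)) X2 = 0"
    for \<tau> :: "real \<times> (real^4)" and x1 x2 X1 Y1 X2 Y2 :: real
  have "\<forall>\<^sub>F \<tau> in nhds 0. \<forall>p \<in> Z \<times> Z. fst (fst p) \<noteq> fst (snd p) \<longrightarrow>
      (\<exists>X1 Y1 X2 Y2. good \<tau> (fst (fst p)) (fst (snd p)) X1 Y1 X2 Y2)"
  proof (intro eventually_ball_finite finite_cartesian_product Z(1) ballI)
    fix p assume "p \<in> Z \<times> Z"
    then obtain x1 y1 x2 y2 where p: "p = ((x1, y1), (x2, y2))" "(x1, y1) \<in> Z" "(x2, y2) \<in> Z"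
      by (metis SigmaE surj_pair)
    show "\<forall>\<^sub>F \<tau> in nhds 0. fst (fst p) \<noteq> fst (snd p) \<longrightarrow>
      (\<exists>X1 Y1 X2 Y2. good \<tau> (fst (fst p)) (fst (snd p)) X1 Y1 X2 Y2)"
    proof (cases "x1 = x2")
      case False
      have "\<forall>\<^sub>F \<tau> in nhds 0. \<exists>X1 Y1 X2 Y2. good \<tau> x1 x2 X1 Y1 X2 Y2"
        unfolding good_def
        by (rule turning_pair_persists[of A y1 y2 B x1 x2 \<rho>])
          (use False turning[rule_format, OF p(2)] turning[rule_format, OF p(3)] \<open>0 < \<rho>\<close> in simp_all)
      then show ?thesis
        by eventually_elim (simp add: p(1))
    qed (simp add: p(1))
  qed
  then obtain e where "0 < e" and all_good: "\<forall>\<tau>. dist \<tau> 0 < e \<longrightarrow> (\<forall>p \<in> Z \<times> Z. fst (fst p) \<noteq> fst (snd p) \<longrightarrow>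
      (\<exists>X1 Y1 X2 Y2. good \<tau> (fst (fst p)) (fst (snd p)) X1 Y1 X2 Y2))"
    unfolding eventually_nhds_metric by blast
  have e: "\<exists>X1 Y1 X2 Y2. good \<tau> (fst z) (fst w) X1 Y1 X2 Y2"
    if "norm \<tau> < e" "z \<in> Z" "w \<in> Z" "fst z \<noteq> fst w" for \<tau> z w
  proof -
    have "(z, w) \<in> Z \<times> Z" "dist \<tau> 0 < e"
      using that by simp_all
    from all_good[rule_format, OF this(2,1)] show ?thesis
      using that(4) by simp
  qed
  define s where "s = min 1 (e / 2)"
  have s: "0 < s" "s \<le> 1" "s\<^sup>2 \<le> e / 2"
    using \<open>0 < e\<close> mult_left_le[of s s] by (auto simp: s_def power2_eq_square)
  have deg_s: "degree (stretch s A) = d"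
    using degree_stretch s(1) deg by simp
  define bad where "bad = {c. degree (perturb_x c B) = d \<and>
     \<not> (smooth_curve (perturb_y c (stretch s A)) (perturb_x c B) \<and>
        finite {(x1, y1, x2, y2). double_normal (perturb_y c (stretch s A)) (perturb_x c B) x1 y1 x2 y2})}"
  have "negligible bad"
    unfolding bad_def by (rule negligible_infinite_double_normals[OF assms deg_s])
  \<comment> \<open>For \<open>d = 2\<close> the perturbation changes the leading coefficient of \<open>B\<close>, which must not vanish.\<close>
  moreover have "negligible {c::real^4. c $ 2 = - coeff B 2}"
    using negligible_hyperplane[of "axis 2 1 :: real^4" "- coeff B 2"]
    by (simp add: inner_axis' axis_eq_0_iff)
  ultimately have "negligible (bad \<union> {c. c $ 2 = - coeff B 2})"
    by (rule negligible_Un)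
  moreover have "\<not> negligible (ball (0::real^4) (e / 2))"
    using \<open>0 < e\<close> by (intro open_not_negligible) auto
  ultimately have "\<not> ball 0 (e / 2) \<subseteq> bad \<union> {c. c $ 2 = - coeff B 2}"
    using negligible_subset by blast
  then obtain c where c: "norm c < e / 2" "c \<notin> bad" "c $ 2 \<noteq> - coeff B 2"
    by (auto simp: subset_eq)
  define P Q where "P = perturb_y c (stretch s A)" and "Q = perturb_x c B"
  have degP: "degree P = d"
    unfolding P_def using degree_perturb_y[of "stretch s A" c] deg_s assms by simp
  have degQ: "degree Q = d"
    unfolding Q_def using degree_perturb_x[of B c] deg c(3) assms by simp
  have smooth: "smooth_curve P Q" and fin: "finite {(x1, y1, x2, y2). double_normal P Q x1 y1 x2 y2}"
    using c(2) degQ unfolding bad_def P_def Q_def by auto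
  have diam: "diameters (sep P Q) =
      (\<lambda>(x1, y1, x2, y2). closed_segment (x1, y1) (x2, y2)) ` {(x1, y1, x2, y2). double_normal P Q x1 y1 x2 y2}"
    unfolding diameters_sep[OF smooth] by (auto simp: image_iff)
  define c' where "c' = vec4 (s * c $ 1) (c $ 2) (c $ 3) (c $ 4)"
  have "norm c' \<le> norm c"
  proof (rule norm_le_componentwise_cart)
    fix i :: 4
    have "\<bar>s * c $ 1\<bar> \<le> \<bar>c $ 1\<bar>"
      using s(1,2) by (simp add: abs_mult mult_left_le_one_le)
    then show "norm (c' $ i) \<le> norm (c $ i)"
      using exhaust_4[of i] by (auto simp: c'_def)
  qed
  then have small: "norm (s\<^sup>2, c') < e"
    using norm_Pair_le[of "s\<^sup>2" c'] s(3) c(1) by simp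
  define ends where "ends \<sigma> = {z \<in> Z. \<exists>p q. \<sigma> = closed_segment p q \<and> \<bar>fst p - fst z\<bar> \<le> \<rho>}"
    for \<sigma> :: "(real \<times> real) set"
  have "\<exists>\<sigma> \<in> diameters (sep P Q). ends \<sigma> = K" if K: "K \<subseteq> Z" "card K = 2" for K
  proof -
    obtain z w where zw: "K = {z, w}" "z \<noteq> w"
      using K(2) by (auto simp: card_2_iff)
    have in_Z: "z \<in> Z" "w \<in> Z" using K(1) zw by auto
    then have ne: "fst z \<noteq> fst w"
      using Z(3) zw(2) by (auto simp: inj_on_def)
    obtain X1 Y1 X2 Y2 where good: "good (s\<^sup>2, c') (fst z) (fst w) X1 Y1 X2 Y2"
      using e[OF small in_Z ne] by blast
    then have near: "\<bar>X1 - fst z\<bar> \<le> \<rho>" "\<bar>X2 - fst w\<bar> \<le> \<rho>"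
      by (simp_all add: good_def)
    have "X1 \<noteq> X2"
      using near \<rho>[OF in_Z ne] by linarith
    have "double_normal P Q X1 (s * Y1) X2 (s * Y2)"
      unfolding P_def Q_def
      by (rule double_normal_stretch[OF s(1) \<open>X1 \<noteq> X2\<close> c'_def]) (use good in \<open>simp_all add: good_def\<close>)
    then have "closed_segment (X1, s * Y1) (X2, s * Y2) \<in> diameters (sep P Q)" (is "?\<sigma> \<in> _")
      unfolding diam by force
    moreover have "ends ?\<sigma> = K"
    proof (rule set_eqI)
      fix t
      have only: "t = t'" if "t \<in> Z" "t' \<in> Z" "\<bar>X - fst t\<bar> \<le> \<rho>" "\<bar>X - fst t'\<bar> \<le> \<rho>" for t' X
      proof (rule ccontr)
        assume "t \<noteq> t'"
        then have "fst t \<noteq> fst t'"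
          using Z(3) that by (auto simp: inj_on_def)
        then show False
          using \<rho>[OF that(1,2)] that(3,4) by linarith
      qed
      show "t \<in> ends ?\<sigma> \<longleftrightarrow> t \<in> K"
      proof
        assume "t \<in> ends ?\<sigma>"
        then obtain p q where "t \<in> Z" "?\<sigma> = closed_segment p q" "\<bar>fst p - fst t\<bar> \<le> \<rho>"
          unfolding ends_def by blast
        then have "p = (X1, s * Y1) \<or> p = (X2, s * Y2)"
          by (auto simp: doubleton_eq_iff)
        then show "t \<in> K"
          using only[of z X1] only[of w X2] near in_Z \<open>t \<in> Z\<close> \<open>\<bar>fst p - fst t\<bar> \<le> \<rho>\<close> zw(1) by auto
      next
        assume "t \<in> K"
        moreover have "?\<sigma> = closed_segment (X2, s * Y2) (X1, s * Y1)"
          by (rule closed_segment_commute)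
        ultimately show "t \<in> ends ?\<sigma>"
          unfolding ends_def using near in_Z zw(1) by fastforce
      qed
    qed
    ultimately show ?thesis by blast
  qed
  then have "{K. K \<subseteq> Z \<and> card K = 2} \<subseteq> ends ` diameters (sep P Q)"
    by blast
  moreover have fin_diam: "finite (diameters (sep P Q))"
    unfolding diam using fin by (rule finite_imageI)
  ultimately have "card {K. K \<subseteq> Z \<and> card K = 2} \<le> card (diameters (sep P Q))"
    by (rule surj_card_le[rotated])
  then have count: "d * (d - 1) choose 2 \<le> card (diameters (sep P Q))"
    using n_subsets[OF Z(1), of 2] Z(2) by simp
  have "algebraic_curve d (sep P Q)"
    unfolding algebraic_curve_def
    using squarefree_sep[of P Q] total_degree_sep[of Q P] degP degQ assms by simp
  then show ?thesis
    using that[of "sep P Q"] no_circle_component[OF fin] fin_diam count by blast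
qed

theorem proposition6p5:
  fixes d :: nat
  assumes "d \<ge> 1"
  shows "ereal_of_enat (RDiam d) \<ge> ereal (1/2 * real d ^ 4 - real d ^ 3 + 1/2 * real d)"
proof (cases "d = 1")
  case True
  have "0 \<le> ereal_of_enat (RDiam 1)"
    by simp
  then show ?thesis
    using True by (simp add: zero_ereal_def)
next
  case False
  then have "2 \<le> d" using assms by simp
  then obtain f where f: "algebraic_curve d f" "\<not> has_circle_component f" "finite (diameters f)"
    "d * (d - 1) choose 2 \<le> card (diameters f)"
    by (rule exists_curve_with_many_diameters)
  have "enat (card (diameters f)) \<le> RDiam d"
    unfolding RDiam_def by (rule Sup_upper) (use f in blast)
  then have le: "ereal (real (card (diameters f))) \<le> ereal_of_enat (RDiam d)"
    using ereal_of_enat_le_iff[of "enat (card (diameters f))" "RDiam d"] by simp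
  have "real (d * (d - 1) choose 2) = real (d * (d - 1)) * (real (d * (d - 1)) - 1) / 2"
  proof -
    have "even (n * (n - 1))" for n :: nat by (cases n) auto
    then have "2 * (n choose 2) = n * (n - 1)" for n :: nat
      by (simp add: choose_two)
    from this[of "d * (d - 1)"] have "2 * real (d * (d - 1) choose 2) = real (d * (d - 1)) * real (d * (d - 1) - 1)"
      by (metis of_nat_mult of_nat_numeral)
    moreover have "1 \<le> d * (d - 1)" using \<open>2 \<le> d\<close> by simp
    ultimately show ?thesis by (simp add: of_nat_diff)
  qed
  also have "\<dots> = 1/2 * real d ^ 4 - real d ^ 3 + 1/2 * real d"
    using assms by (simp add: of_nat_diff power4_eq_xxxx power3_eq_cube field_simps)
  finally have "1/2 * real d ^ 4 - real d ^ 3 + 1/2 * real d \<le> real (card (diameters f))"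
    using f(4) by (metis of_nat_le_iff)
  then show ?thesis
    using le by (meson ereal_less_eq(3) order_trans)
qed

end
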